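(* Let $X_S$, $X_U$ be random variables (taking values in arbitrary standard Borel spaces) and $Y$ a random variable, all defined on a common probability space, such that: (i) $Y$ takes values in $\{0,1\}$; (ii) $X_S$ and $X_U$ are conditionally independent given $Y$; (iii) $X_S$ and $Y$ are not independent. Then the joint distribution of $(X_S,X_U,Y)$ can be written in terms of (i.e., is determined by) the joint distributions of $(X_S,Y)$ and of $(X_S,X_U)$. Specifically, let $\hat Y$ be a $\{0,1\}$-valued random variable (a pseudo-label) drawn from $X_S$ alone according to $\hat Y\mid X_S\sim\operatorname{Bernoulli}(\Pr[Y=1\mid X_S])$, so that $\hat Y$ is conditionally independent of $(X_U,Y)$ given $X_S$, and let $$\epsilon_0:=\Pr[\hat Y=0\mid Y=0],\qquad \epsilon_1:=\Pr[\hat Y=1\mid Y=1].$$ Then $$\epsilon_0+\epsilon_1>1,$$ and, almost surely, $$\Pr[Y=1\mid X_U]=\frac{\Pr[\hat Y=1\mid X_U]+\epsilon_0-1}{\epsilon_0+\epsilon_1-1},$$ $$\Pr[Y=1\mid X_S,X_U]=\sigma\Big(\operatorname{logit}(\Pr[Y=1\mid X_S])+\operatorname{logit}(\Pr[Y=1\mid X_U])-\operatorname{logit}(\Pr[Y=1])\Big).$$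
   Context: $\sigma(t)=1/(1+e^{-t})$ is the sigmoid and $\operatorname{logit}(p)=\log\frac{p}{1-p}$ is its inverse, with the conventions $\operatorname{logit}(0)=-\infty$, $\operatorname{logit}(1)=+\infty$, $\sigma(-\infty)=0$, $\sigma(+\infty)=1$; the last identity is understood almost surely (the indeterminate case where one of $\operatorname{logit}(\Pr[Y=1\mid X_S])$, $\operatorname{logit}(\Pr[Y=1\mid X_U])$ is $+\infty$ and the other is $-\infty$ has probability zero). "Determined by" means: any two triples satisfying (i)-(iii) with the same joint law of $(X_S,Y)$ and the same joint law of $(X_S,X_U)$ have the same joint law of $(X_S,X_U,Y)$. *)

theory Defs
  imports "HOL-Probability.Probability"
begin

definition standard_borel :: "'a measure \<Rightarrow> bool" where
  "standard_borel N \<longleftrightarrow>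
     (\<exists>T. topspace T = space N \<and> completely_metrizable_space T \<and> second_countable T \<and>
          sets N = sigma_sets (space N) {U. openin T U})"

text \<open>Codomains are passed explicitly, so \<open>sigma_gen M N X\<close> is the sub-\<open>\<sigma>\<close>-algebra of \<open>M\<close>
  generated by \<open>X\<close>.\<close>

definition sigma_gen :: "'w measure \<Rightarrow> 'a measure \<Rightarrow> ('w \<Rightarrow> 'a) \<Rightarrow> 'w measure" where
  "sigma_gen M N X = vimage_algebra (space M) X N"

text \<open>A fixed version of the conditional probability of \<open>{\<omega>. P \<omega>}\<close> given the
  sub-\<open>\<sigma>\<close>-algebra \<open>F\<close>; it is determined only almost surely.\<close>

definition cond_pr :: "'w measure \<Rightarrow> 'w measure \<Rightarrow> ('w \<Rightarrow> bool) \<Rightarrow> 'w \<Rightarrow> real" where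
  "cond_pr M F P = real_cond_exp M F (indicator {\<omega> \<in> space M. P \<omega>})"

text \<open>The library's \<open>indep_var\<close> forces both variables to have the same value type, so
  independence is expressed through the generated \<open>\<sigma>\<close>-algebras.\<close>

definition indep_rv ::
  "'w measure \<Rightarrow> 'a measure \<Rightarrow> ('w \<Rightarrow> 'a) \<Rightarrow> 'b measure \<Rightarrow> ('w \<Rightarrow> 'b) \<Rightarrow> bool" where
  "indep_rv M N X N' X' \<longleftrightarrow>
     prob_space.indep_set M (sets (sigma_gen M N X)) (sets (sigma_gen M N' X'))"

definition cond_indep_rv ::
  "'w measure \<Rightarrow> 'a measure \<Rightarrow> ('w \<Rightarrow> 'a) \<Rightarrow> 'b measure \<Rightarrow> ('w \<Rightarrow> 'b) \<Rightarrow>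
   'c measure \<Rightarrow> ('w \<Rightarrow> 'c) \<Rightarrow> bool" where
  "cond_indep_rv M N X N' X' K Z \<longleftrightarrow>
     (\<forall>A \<in> sets N. \<forall>B \<in> sets N'. AE \<omega> in M.
        cond_pr M (sigma_gen M K Z) (\<lambda>\<omega>. X \<omega> \<in> A \<and> X' \<omega> \<in> B) \<omega> =
        cond_pr M (sigma_gen M K Z) (\<lambda>\<omega>. X \<omega> \<in> A) \<omega> *
        cond_pr M (sigma_gen M K Z) (\<lambda>\<omega>. X' \<omega> \<in> B) \<omega>)"

abbreviation bit_space :: "nat measure" where
  "bit_space \<equiv> count_space {0, 1}"

text \<open>Measurability into \<open>bit_space\<close> includes being \<open>{0,1}\<close>-valued everywhere.\<close>

definition admissible_triple ::
  "'w measure \<Rightarrow> 's measure \<Rightarrow> 'u measure \<Rightarrow> ('w \<Rightarrow> 's) \<Rightarrow> ('w \<Rightarrow> 'u) \<Rightarrow> ('w \<Rightarrow> nat) \<Rightarrow> bool" where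
  "admissible_triple M NS NU XS XU Y \<longleftrightarrow>
     prob_space M \<and> XS \<in> measurable M NS \<and> XU \<in> measurable M NU \<and>
     Y \<in> measurable M bit_space \<and>
     cond_indep_rv M NS XS NU XU bit_space Y \<and>
     \<not> indep_rv M NS XS bit_space Y"

definition pseudo_label ::
  "'w measure \<Rightarrow> 's measure \<Rightarrow> 'u measure \<Rightarrow> ('w \<Rightarrow> 's) \<Rightarrow> ('w \<Rightarrow> 'u) \<Rightarrow> ('w \<Rightarrow> nat) \<Rightarrow>
   ('w \<Rightarrow> nat) \<Rightarrow> bool" where
  "pseudo_label M NS NU XS XU Y Yh \<longleftrightarrow>
     Yh \<in> measurable M bit_space \<and>
     (AE \<omega> in M. cond_pr M (sigma_gen M NS XS) (\<lambda>\<omega>. Yh \<omega> = 1) \<omega> =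
                 cond_pr M (sigma_gen M NS XS) (\<lambda>\<omega>. Y \<omega> = 1) \<omega>) \<and>
     cond_indep_rv M bit_space Yh (NU \<Otimes>\<^sub>M bit_space) (\<lambda>\<omega>. (XU \<omega>, Y \<omega>)) NS XS"

text \<open>Outside \<open>[0,1]\<close> the value of \<open>logit\<close> is irrelevant: conditional probabilities lie in
  \<open>[0,1]\<close> almost surely.\<close>

definition logit :: "real \<Rightarrow> ereal" where
  "logit p = (if p = 0 then -\<infinity> else if p = 1 then \<infinity> else ereal (ln (p / (1 - p))))"

definition sigmoid :: "ereal \<Rightarrow> real" where
  "sigmoid t = (if t = -\<infinity> then 0 else if t = \<infinity> then 1 else 1 / (1 + exp (- real_of_ereal t)))"

end

theory Submission
  imports Defs
begin

text \<open>Write \<open>f\<close>, \<open>g\<close> for the posteriors of \<open>Y = 1\<close> given \<open>XS\<close> and \<open>XU\<close>, and \<open>p = Pr[Y = 1]\<close>. Conditional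
  independence makes expectations of the form \<open>E[\<phi>(XS) \<psi>(XU); Y = y]\<close> factorise. Comparing the two
  factorisations on rectangles gives \<open>E[1_C d; Y = 1] = E[1_C f g / p]\<close> with
  \<open>d = f g / p + (1 - f) (1 - g) / (1 - p)\<close>, first for rectangles \<open>C\<close> and then for every \<open>C\<close> generated by
  both views; hence the posterior given both views is \<open>(f g / p) / d\<close>, which is the sigmoid formula.
  The pseudo-label has \<open>Pr[Yh = 1, Y = 1] = E[f^2]\<close>, so that \<open>\<epsilon>0 + \<epsilon>1 - 1\<close> is the variance of \<open>f\<close>
  divided by \<open>p (1 - p)\<close>, positive by dependence. For uniqueness, \<open>Pr[XU \<in> B, Y = 1]\<close> solves a linear
  equation whose coefficient \<open>Pr[XS \<in> A, Y = 1] - Pr[XS \<in> A] p\<close> is nonzero for some \<open>A\<close>.\<close>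

text \<open>Put q = 1 - p. The difference d * 1[Y = 1] - f g / p equals (1 - f) (1 - g) / q on
  \<open>Y = 1\<close> and -f g / p on \<open>Y = 0\<close>. Over a rectangle A x B, factorising the
  first part within \<open>Y = 1\<close> gives E[1_A f (1 - f)] E[1_B g (1 - g)] / (p q);
  factorising the second within \<open>Y = 0\<close> gives minus the same number, because passing to
  the other class exchanges f with 1 - f and g with 1 - g. This symmetry takes the place of
  disintegrations and densities, so the argument stays with integrals over \<open>M\<close>.
  Division is postponed: the identity is first proved as d * posterior = f g / p. The factor d
  vanishes only where one of f, g is 0 and the other is 1, and this is a null event because a
  posterior equal to 0 or 1 determines \<open>Y\<close> almost surely. The same fact rules out the
  sum of opposite infinities in the log-odds. Dependence also yields 0 < p < 1. Given
  \<open>Y\<close>, the pseudo-label is not informed by \<open>XU\<close>, so Pr[Yh = 1 | XU] is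
  affine in g with slope \<epsilon>0 + \<epsilon>1 - 1; debiasing inverts this affine map.\<close>

section \<open>Conditional probabilities given a random variable\<close>

lemma sets_sigma_gen:
  assumes "X \<in> space M \<rightarrow> space N"
  shows "sets (sigma_gen M N X) = {{\<omega> \<in> space M. X \<omega> \<in> A} | A. A \<in> sets N}"
proof -
  have "{X -` A \<inter> space M | A. A \<in> sets N} = {{\<omega> \<in> space M. X \<omega> \<in> A} | A. A \<in> sets N}"
    by (intro Collect_cong ex_cong1) auto
  then show ?thesis
    using assms by (simp add: sigma_gen_def sets_vimage_algebra2)
qed

lemma space_sigma_gen [simp]: "space (sigma_gen M N X) = space M"
  by (simp add: sigma_gen_def)

lemma subalgebra_sigma_gen:
  "X \<in> measurable M N \<Longrightarrow> subalgebra M (sigma_gen M N X)"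
  using sets_image_in_sets[of M "space M" X N] by (auto simp: subalgebra_def sigma_gen_def)

lemma measurable_sigma_gen:
  assumes "X \<in> space M \<rightarrow> space N" "Y \<in> measurable M K" "f \<in> measurable N K"
    and "\<And>\<omega>. \<omega> \<in> space M \<Longrightarrow> Y \<omega> = f (X \<omega>)"
  shows "Y \<in> measurable (sigma_gen M N X) K"
proof -
  have "X \<in> measurable (sigma_gen M N X) N"
    unfolding sigma_gen_def using assms(1) by (rule measurable_vimage_algebra1)
  then have "(\<lambda>\<omega>. f (X \<omega>)) \<in> measurable (sigma_gen M N X) K"
    using assms(3) by (rule measurable_compose)
  then show ?thesis
    using assms(4) by (subst measurable_cong[where g="\<lambda>\<omega>. f (X \<omega>)"]) auto
qed

text \<open>The level set of \<open>f\<close> through \<omega>' is the preimage under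
  \<open>X\<close> of a measurable set, so it contains the whole fibre of \<open>X\<close> through
  \<omega>'. It makes conditional probabilities given \<open>Z\<close> constant on each event
  \<open>Z = z\<close>.\<close>

lemma sigma_gen_measurable_factors:
  fixes f :: "'w \<Rightarrow> real"
  assumes X: "X \<in> space M \<rightarrow> space N" and f: "f \<in> borel_measurable (sigma_gen M N X)"
    and "\<omega> \<in> space M" "\<omega>' \<in> space M" "X \<omega> = X \<omega>'"
  shows "f \<omega> = f \<omega>'"
proof -
  have "f -` {f \<omega>'} \<inter> space M \<in> sets (sigma_gen M N X)"
    using measurable_sets[OF f, of "{f \<omega>'}"] by simp
  then obtain A where A: "f -` {f \<omega>'} \<inter> space M = {\<omega> \<in> space M. X \<omega> \<in> A}"
    unfolding sets_sigma_gen[OF X] by blast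
  have "\<omega>' \<in> f -` {f \<omega>'} \<inter> space M"
    using assms(4) by simp
  then have "\<omega> \<in> f -` {f \<omega>'} \<inter> space M"
    unfolding A using assms(3,5) by simp
  then show ?thesis by simp
qed

section \<open>Testing conditional expectations against bounded weights\<close>

context sigma_finite_subalgebra
begin

text \<open>The hypothesis on indicators says that the conditional expectation of \<open>k\<close>
  is \<open>c\<close> times that of \<open>k'\<close>; an \<open>F\<close>-measurable factor \<phi>
  can then be pulled through both. This passes from events to functions in one view while the other
  view is frozen inside \<open>k\<close>.\<close>

lemma integral_mult_proportional:
  fixes k k' \<phi> :: "'a \<Rightarrow> real"
  assumes k: "integrable M k" "integrable M k'"
    and eq: "\<And>A. A \<in> sets F \<Longrightarrow> (\<integral>x. indicator A x * k x \<partial>M) = c * (\<integral>x. indicator A x * k' x \<partial>M)"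
    and \<phi>: "\<phi> \<in> borel_measurable F" "integrable M (\<lambda>x. \<phi> x * k x)" "integrable M (\<lambda>x. \<phi> x * k' x)"
  shows "(\<integral>x. \<phi> x * k x \<partial>M) = c * (\<integral>x. \<phi> x * k' x \<partial>M)"
proof -
  have [measurable]: "k \<in> borel_measurable M" "k' \<in> borel_measurable M" using k by auto
  have [measurable]: "\<phi> \<in> borel_measurable M" by (rule measurable_from_subalg[OF subalg \<phi>(1)])
  have "AE x in M. real_cond_exp M F k x = c * real_cond_exp M F k' x"
  proof (rule real_cond_exp_charact)
    fix A assume A: "A \<in> sets F"
    have "(\<integral>x\<in>A. c * real_cond_exp M F k' x \<partial>M) = c * (\<integral>x\<in>A. real_cond_exp M F k' x \<partial>M)"
      by (rule set_integral_mult_right)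
    also have "\<dots> = c * (\<integral>x\<in>A. k' x \<partial>M)"
      using real_cond_exp_intA[OF k(2) A] by (rule arg_cong[OF sym])
    finally have "(\<integral>x\<in>A. c * real_cond_exp M F k' x \<partial>M) = c * (\<integral>x\<in>A. k' x \<partial>M)" .
    then show "(\<integral>x\<in>A. k x \<partial>M) = (\<integral>x\<in>A. c * real_cond_exp M F k' x \<partial>M)"
      using eq[OF A] by (simp only: set_lebesgue_integral_def real_scaleR_def)
  next
    show "integrable M (\<lambda>x. c * real_cond_exp M F k' x)"
      using real_cond_exp_int(1)[OF k(2)] by simp
  qed (simp_all add: k)
  then have "(\<integral>x. \<phi> x * real_cond_exp M F k x \<partial>M) = (\<integral>x. c * (\<phi> x * real_cond_exp M F k' x) \<partial>M)"
    by (intro integral_cong_AE) (auto simp: algebra_simps)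
  then show ?thesis
    using real_cond_exp_intg(2)[OF \<phi>(2,1)] real_cond_exp_intg(2)[OF \<phi>(3,1)] by simp
qed

end

context prob_space
begin

lemma sigma_finite_subalgebra_sigma_gen:
  assumes "X \<in> measurable M N"
  shows "sigma_finite_subalgebra M (sigma_gen M N X)"
  by (intro finite_measure_subalgebra_is_sigma_finite finite_measure_subalgebra.intro
      finite_measure_subalgebra_axioms.intro subalgebra_sigma_gen assms finite_measure_axioms)

lemma cond_pr_measurable [measurable]:
  "cond_pr M F P \<in> borel_measurable F" "cond_pr M F P \<in> borel_measurable M"
  by (simp_all add: cond_pr_def)

lemma AE_cond_pr_bounds:
  assumes "X \<in> measurable M N" and [measurable]: "{\<omega> \<in> space M. P \<omega>} \<in> sets M"
  shows "AE \<omega> in M. 0 \<le> cond_pr M (sigma_gen M N X) P \<omega> \<and> cond_pr M (sigma_gen M N X) P \<omega> \<le> 1"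
proof -
  interpret sigma_finite_subalgebra M "sigma_gen M N X"
    by (rule sigma_finite_subalgebra_sigma_gen[OF assms(1)])
  have i: "integrable M (indicator {\<omega> \<in> space M. P \<omega>} :: _ \<Rightarrow> real)"
    by (simp add: emeasure_eq_measure)
  show ?thesis
    unfolding cond_pr_def
    using real_cond_exp_ge_c[OF i, of 0] real_cond_exp_le_c[OF i, of 1] by auto
qed

text \<open>An almost sure bound on \<phi> is enough for integrability. It has this weak form
  because the weights used later contain conditional probabilities, which are bounded by 1 only
  almost surely.\<close>

lemma integral_cond_pr:
  assumes "X \<in> measurable M N" and [measurable]: "{\<omega> \<in> space M. P \<omega>} \<in> sets M"
    and \<phi>: "\<phi> \<in> borel_measurable (sigma_gen M N X)" "AE \<omega> in M. \<bar>\<phi> \<omega>\<bar> \<le> 1"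
  shows "(\<integral>\<omega>. \<phi> \<omega> * cond_pr M (sigma_gen M N X) P \<omega> \<partial>M) =
         (\<integral>\<omega>. \<phi> \<omega> * indicator {\<omega> \<in> space M. P \<omega>} \<omega> \<partial>M)"
proof -
  interpret sigma_finite_subalgebra M "sigma_gen M N X"
    by (rule sigma_finite_subalgebra_sigma_gen[OF assms(1)])
  have [measurable]: "\<phi> \<in> borel_measurable M" by (rule measurable_from_subalg[OF subalg \<phi>(1)])
  show ?thesis
    unfolding cond_pr_def
  proof (rule real_cond_exp_intg(2)[OF _ \<phi>(1)])
    show "integrable M (\<lambda>\<omega>. \<phi> \<omega> * indicator {\<omega> \<in> space M. P \<omega>} \<omega>)"
      by (rule integrable_const_bound[where B=1])
        (use \<phi>(2) in \<open>auto split: split_indicator elim!: eventually_mono\<close>)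
  qed simp
qed

lemma integral_indicator_mult_indicator:
  "(\<integral>\<omega>. indicator {\<omega> \<in> space M. P \<omega>} \<omega> * indicator {\<omega> \<in> space M. Q \<omega>} \<omega> \<partial>M) =
   \<P>(\<omega> in M. P \<omega> \<and> Q \<omega>)"
proof -
  have "(\<lambda>\<omega>. indicator {\<omega> \<in> space M. P \<omega>} \<omega> * indicator {\<omega> \<in> space M. Q \<omega>} \<omega> :: real) =
      indicator {\<omega> \<in> space M. P \<omega> \<and> Q \<omega>}"
    by (auto split: split_indicator)
  then show ?thesis by (simp add: Int_def conj_ac)
qed

text \<open>Since \<open>j\<close> may change sign, the induction over the sets generated by
  rectangles is run on the integral itself. Complements need the total integral to vanish, which is
  the rectangle of the two full spaces; disjoint unions use countable additivity.\<close>

lemma set_integral_eq_0_generated_by_pair: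
  fixes j :: "'a \<Rightarrow> real"
  assumes [measurable]: "X \<in> measurable M N" "X' \<in> measurable M N'" and j: "integrable M j"
    and rect: "\<And>A B. A \<in> sets N \<Longrightarrow> B \<in> sets N' \<Longrightarrow>
      (\<integral>\<omega>\<in>{\<omega> \<in> space M. X \<omega> \<in> A \<and> X' \<omega> \<in> B}. j \<omega> \<partial>M) = 0"
    and C: "C \<in> sets (sigma_gen M (N \<Otimes>\<^sub>M N') (\<lambda>\<omega>. (X \<omega>, X' \<omega>)))"
  shows "(\<integral>\<omega>\<in>C. j \<omega> \<partial>M) = 0"
proof -
  let ?Z = "\<lambda>\<omega>. (X \<omega>, X' \<omega>)"
  let ?pre = "\<lambda>D. {\<omega> \<in> space M. ?Z \<omega> \<in> D}"
  have Z[measurable]: "?Z \<in> measurable M (N \<Otimes>\<^sub>M N')" by measurable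
  obtain D where D: "D \<in> sets (N \<Otimes>\<^sub>M N')" "C = ?pre D"
    using C sets_sigma_gen[of ?Z M "N \<Otimes>\<^sub>M N'"] measurable_space[OF Z] by auto
  have pre[measurable]: "?pre D \<in> sets M" if "D \<in> sets (N \<Otimes>\<^sub>M N')" for D
    using measurable_sets[OF Z that] by (simp add: vimage_def Int_def conj_commute)
  have si: "set_integrable M A j" if "A \<in> sets M" for A
    unfolding set_integrable_def using integrable_mult_indicator[OF that j] .
  have "(\<integral>\<omega>. j \<omega> \<partial>M) = (\<integral>\<omega>\<in>{\<omega> \<in> space M. X \<omega> \<in> space N \<and> X' \<omega> \<in> space N'}. j \<omega> \<partial>M)"
    unfolding set_lebesgue_integral_def
    by (intro Bochner_Integration.integral_cong)
       (auto simp: measurable_space[OF assms(1)] measurable_space[OF assms(2)])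
  then have total: "(\<integral>\<omega>. j \<omega> \<partial>M) = 0"
    using rect[of "space N" "space N'"] by simp
  have "(\<integral>\<omega>\<in>?pre D. j \<omega> \<partial>M) = 0"
    using Int_stable_pair_measure_generator[of N N'] pair_measure_closed[of N N'] D(1)[unfolded sets_pair_measure]
  proof (induction rule: sigma_sets_induct_disjoint)
    case (basic D)
    then obtain A B where "D = A \<times> B" "A \<in> sets N" "B \<in> sets N'" by auto
    then show ?case using rect[of A B] by simp
  next
    case empty
    then show ?case by (simp add: set_lebesgue_integral_def)
  next
    case (compl D)
    then have D: "D \<in> sets (N \<Otimes>\<^sub>M N')" by (simp add: sets_pair_measure)
    have "?pre (space N \<times> space N' - D) = space M - ?pre D"
      using measurable_space[OF assms(1)] measurable_space[OF assms(2)] by auto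
    moreover have "(\<integral>\<omega>\<in>space M - ?pre D. j \<omega> \<partial>M) =
        (\<integral>\<omega>. j \<omega> - indicator (?pre D) \<omega> *\<^sub>R j \<omega> \<partial>M)"
      unfolding set_lebesgue_integral_def
      by (intro Bochner_Integration.integral_cong) (auto split: split_indicator)
    moreover have "\<dots> = 0"
      using total compl(2) si[OF pre[OF D]] j
      by (simp add: set_lebesgue_integral_def set_integrable_def)
    ultimately show ?case by simp
  next
    case (union D)
    then have [measurable]: "D i \<in> sets (N \<Otimes>\<^sub>M N')" for i by (auto simp: sets_pair_measure)
    have eq: "?pre (\<Union>i. D i) = (\<Union>i. ?pre (D i))" by auto
    have "(\<integral>\<omega>\<in>(\<Union>i. ?pre (D i)). j \<omega> \<partial>M) = (\<Sum>i. \<integral>\<omega>\<in>?pre (D i). j \<omega> \<partial>M)"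
      using union(1) by (intro lebesgue_integral_countable_add si)
        (fastforce simp: disjoint_family_on_def)+
    then show ?case unfolding eq using union(3) by simp
  qed
  then show ?thesis by (simp add: D)
qed

section \<open>Conditioning on a discrete variable\<close>

lemma sets_measurable_Collect:
  assumes "X \<in> measurable M N" "A \<in> sets N"
  shows "{\<omega> \<in> space M. X \<omega> \<in> A} \<in> sets M"
  using measurable_sets[OF assms] by (simp add: vimage_def Int_def conj_commute)

text \<open>The conditional probability is constant on \<open>Z = z\<close>, so integrating it over
  that event multiplies the constant by the probability of the event. The product form stays valid
  on null atoms.\<close>

lemma cond_pr_on_atom:
  assumes Z: "Z \<in> measurable M K" and z: "{z} \<in> sets K" and P: "{\<omega> \<in> space M. P \<omega>} \<in> sets M"
    and \<omega>: "\<omega> \<in> space M" "Z \<omega> = z"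
  shows "cond_pr M (sigma_gen M K Z) P \<omega> * \<P>(\<omega> in M. Z \<omega> = z) = \<P>(\<omega> in M. P \<omega> \<and> Z \<omega> = z)"
proof -
  let ?c = "cond_pr M (sigma_gen M K Z) P" and ?I = "indicator {\<omega> \<in> space M. Z \<omega> = z} :: _ \<Rightarrow> real"
  have "{\<omega> \<in> space M. Z \<omega> = z} \<in> sets (sigma_gen M K Z)"
    using z measurable_space[OF Z] by (subst sets_sigma_gen) auto
  then have I: "?I \<in> borel_measurable (sigma_gen M K Z)" by simp
  have const: "?c \<omega>' = ?c \<omega>" if "\<omega>' \<in> space M" "Z \<omega>' = z" for \<omega>'
    by (rule sigma_gen_measurable_factors[of Z M K])
      (use that \<omega> measurable_space[OF Z] in simp_all)
  have "(\<integral>\<omega>'. ?I \<omega>' * ?c \<omega>' \<partial>M) = (\<integral>\<omega>'. ?c \<omega> * ?I \<omega>' \<partial>M)"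
    by (intro Bochner_Integration.integral_cong) (auto simp: const split: split_indicator)
  moreover have "(\<integral>\<omega>'. ?I \<omega>' * ?c \<omega>' \<partial>M) = (\<integral>\<omega>'. ?I \<omega>' * indicator {\<omega> \<in> space M. P \<omega>} \<omega>' \<partial>M)"
    by (rule integral_cond_pr[OF Z P I]) (simp add: indicator_def)
  moreover have "\<P>(\<omega> in M. Z \<omega> = z \<and> P \<omega>) = \<P>(\<omega> in M. P \<omega> \<and> Z \<omega> = z)"
    by (simp add: conj_commute)
  moreover have "{\<omega> \<in> space M. Z \<omega> = z} \<inter> space M = {\<omega> \<in> space M. Z \<omega> = z}" by blast
  ultimately show ?thesis
    by (simp add: integral_indicator_mult_indicator)
qed

text \<open>An almost sure identity holds at some point of any atom of positive probability, and
  there \<open>cond_pr_on_atom\<close> turns it into an identity of numbers. On a null atom both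
  sides are 0, which is why nothing is divided.\<close>

lemma cond_indep_on_atom:
  assumes ci: "cond_indep_rv M N X N' X' K Z"
    and X: "X \<in> measurable M N" and X': "X' \<in> measurable M N'"
    and Z: "Z \<in> measurable M K" and z: "{z} \<in> sets K" and A: "A \<in> sets N" and B: "B \<in> sets N'"
  shows "\<P>(\<omega> in M. X \<omega> \<in> A \<and> X' \<omega> \<in> B \<and> Z \<omega> = z) * \<P>(\<omega> in M. Z \<omega> = z) =
         \<P>(\<omega> in M. X \<omega> \<in> A \<and> Z \<omega> = z) * \<P>(\<omega> in M. X' \<omega> \<in> B \<and> Z \<omega> = z)"
proof -
  let ?C = "\<lambda>P. cond_pr M (sigma_gen M K Z) P"
  have Zz: "{\<omega> \<in> space M. Z \<omega> = z} \<in> sets M"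
    using sets_measurable_Collect[OF Z z] by simp
  have XA: "{\<omega> \<in> space M. X \<omega> \<in> A} \<in> sets M" and XB: "{\<omega> \<in> space M. X' \<omega> \<in> B} \<in> sets M"
    using sets_measurable_Collect X X' A B by blast+
  have XAB: "{\<omega> \<in> space M. X \<omega> \<in> A \<and> X' \<omega> \<in> B} \<in> sets M"
    by (rule sets.sets_Collect_conj[OF XB XA])
  show ?thesis
  proof (cases "\<P>(\<omega> in M. Z \<omega> = z) = 0")
    case True
    have "\<P>(\<omega> in M. X \<omega> \<in> A \<and> Z \<omega> = z) \<le> \<P>(\<omega> in M. Z \<omega> = z)"
      using Zz by (intro finite_measure_mono) auto
    then have "\<P>(\<omega> in M. X \<omega> \<in> A \<and> Z \<omega> = z) = 0"
      using True measure_nonneg[of M "{\<omega> \<in> space M. X \<omega> \<in> A \<and> Z \<omega> = z}"] by linarith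
    then show ?thesis using True by simp
  next
    case False
    have ae: "AE \<omega> in M. ?C (\<lambda>\<omega>. X \<omega> \<in> A \<and> X' \<omega> \<in> B) \<omega> =
        ?C (\<lambda>\<omega>. X \<omega> \<in> A) \<omega> * ?C (\<lambda>\<omega>. X' \<omega> \<in> B) \<omega>"
      using ci A B by (simp add: cond_indep_rv_def)
    have "\<exists>\<omega>\<in>space M. Z \<omega> = z \<and> ?C (\<lambda>\<omega>. X \<omega> \<in> A \<and> X' \<omega> \<in> B) \<omega> =
        ?C (\<lambda>\<omega>. X \<omega> \<in> A) \<omega> * ?C (\<lambda>\<omega>. X' \<omega> \<in> B) \<omega>"
    proof (rule ccontr)
      assume no: "\<not> ?thesis"
      have "AE \<omega> in M. Z \<omega> \<noteq> z"
        using ae AE_space by eventually_elim (use no in blast)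
      then show False
        using False by (simp add: prob_Collect_eq_0[OF Zz])
    qed
    then obtain \<omega> where \<omega>: "\<omega> \<in> space M" "Z \<omega> = z"
      and eq: "?C (\<lambda>\<omega>. X \<omega> \<in> A \<and> X' \<omega> \<in> B) \<omega> = ?C (\<lambda>\<omega>. X \<omega> \<in> A) \<omega> * ?C (\<lambda>\<omega>. X' \<omega> \<in> B) \<omega>"
      by blast
    note atom = cond_pr_on_atom[OF Z z _ \<omega>]
    show ?thesis
      unfolding atom[OF XA, symmetric] atom[OF XB, symmetric]
        atom[OF XAB, unfolded eq conj_assoc, symmetric]
      by (simp only: mult_ac)
  qed
qed

text \<open>The events generated by a bit are the empty set, \<open>Y = 0\<close>,
  \<open>Y = 1\<close> and the whole space; \<open>Y = 0\<close> follows from \<open>Y = 1\<close>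
  by complement. Its contrapositive extracts from dependence a single set \<open>A\<close> on which
  the product rule fails.\<close>

lemma indep_rv_bitI:
  assumes X: "X \<in> measurable M N" and Y: "Y \<in> measurable M bit_space"
    and eq: "\<And>A. A \<in> sets N \<Longrightarrow>
      \<P>(\<omega> in M. X \<omega> \<in> A \<and> Y \<omega> = 1) = \<P>(\<omega> in M. X \<omega> \<in> A) * \<P>(\<omega> in M. Y \<omega> = 1)"
  shows "indep_rv M N X bit_space Y"
  unfolding indep_rv_def
proof (rule indep_setI)
  show "sets (sigma_gen M N X) \<subseteq> events" "sets (sigma_gen M bit_space Y) \<subseteq> events"
    using subalgebra_sigma_gen[OF X] subalgebra_sigma_gen[OF Y] by (auto simp: subalgebra_def)
  fix a b assume "a \<in> sets (sigma_gen M N X)" "b \<in> sets (sigma_gen M bit_space Y)"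
  moreover have "X \<in> space M \<rightarrow> space N" "Y \<in> space M \<rightarrow> space bit_space"
    using measurable_space[OF X] measurable_space[OF Y] by auto
  ultimately obtain A Z where A: "A \<in> sets N" "a = {\<omega> \<in> space M. X \<omega> \<in> A}"
    and Z: "Z \<subseteq> {0, 1}" "b = {\<omega> \<in> space M. Y \<omega> \<in> Z}"
    by (auto simp: sets_sigma_gen)
  have a: "a \<in> events" using sets_measurable_Collect[OF X A(1)] A(2) by simp
  have Y1: "{\<omega> \<in> space M. Y \<omega> = 1} \<in> events"
    using sets_measurable_Collect[OF Y, of "{1}"] by simp
  have Y01: "Y \<omega> = 0 \<or> Y \<omega> = 1" if "\<omega> \<in> space M" for \<omega>
    using measurable_space[OF Y that] by simp
  have aY1: "prob (a \<inter> {\<omega> \<in> space M. Y \<omega> = 1}) = prob a * prob {\<omega> \<in> space M. Y \<omega> = 1}"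
    using eq[OF A(1)] by (simp add: A(2) Int_def conj_ac)
  have "Z = {} \<or> Z = {0} \<or> Z = {1} \<or> Z = {0, 1}" using Z(1) by blast
  moreover have "{\<omega> \<in> space M. Y \<omega> = 0} = space M - {\<omega> \<in> space M. Y \<omega> = 1}"
    "{\<omega> \<in> space M. Y \<omega> \<in> {0, 1}} = space M"
    using Y01 by (safe; force)+
  ultimately consider "b = {}" | "b = space M - {\<omega> \<in> space M. Y \<omega> = 1}"
    | "b = {\<omega> \<in> space M. Y \<omega> = 1}" | "b = space M"
    unfolding Z(2) by (elim disjE) simp_all
  then show "prob (a \<inter> b) = prob a * prob b"
  proof cases
    case 2
    have "a \<inter> b = a - a \<inter> {\<omega> \<in> space M. Y \<omega> = 1}"
      using sets.sets_into_space[OF a] by (auto simp: 2)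
    then have "prob (a \<inter> b) = prob a - prob (a \<inter> {\<omega> \<in> space M. Y \<omega> = 1})"
      using finite_measure_Diff[OF a sets.Int[OF a Y1]] by auto
    moreover have "prob b = 1 - prob {\<omega> \<in> space M. Y \<omega> = 1}"
      unfolding 2 by (rule prob_compl[OF Y1])
    ultimately show ?thesis by (simp only: aY1 right_diff_distrib mult_1_right)
  next
    case 3
    then show ?thesis using aY1 by simp
  next
    case 4
    then show ?thesis using sets.Int_space_eq2[OF a] by (simp add: prob_space)
  qed simp
qed

end

text \<open>The boxes are stable under intersection and generate the nested product, so a finite
  measure is fixed by its values on them. The inner product enters through its own generator of
  rectangles.\<close>

lemma emeasure_eqI_triple:
  assumes P: "finite_measure P" "sets P = sets (N \<Otimes>\<^sub>M N' \<Otimes>\<^sub>M K)"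
    and Q: "sets Q = sets (N \<Otimes>\<^sub>M N' \<Otimes>\<^sub>M K)"
    and eq: "\<And>A B Z. A \<in> sets N \<Longrightarrow> B \<in> sets N' \<Longrightarrow> Z \<in> sets K \<Longrightarrow>
      emeasure P (A \<times> B \<times> Z) = emeasure Q (A \<times> B \<times> Z)"
  shows "P = Q"
proof -
  interpret finite_measure P by fact
  let ?Eb = "{B \<times> Z |B Z. B \<in> sets N' \<and> Z \<in> sets K}"
  let ?\<Omega> = "space N \<times> space (N' \<Otimes>\<^sub>M K)"
  let ?E = "{A \<times> R |A R. A \<in> sets N \<and> R \<in> ?Eb}"
  have Eb: "?Eb \<subseteq> Pow (space (N' \<Otimes>\<^sub>M K))" "sets (N' \<Otimes>\<^sub>M K) = sigma_sets (space (N' \<Otimes>\<^sub>M K)) ?Eb"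
    using pair_measure_closed[of N' K] by (simp_all add: space_pair_measure sets_pair_measure)
  have top: "space (N' \<Otimes>\<^sub>M K) \<in> ?Eb"
    by (auto simp: space_pair_measure)
  have E: "?E \<subseteq> Pow ?\<Omega>"
  proof
    fix X assume "X \<in> ?E"
    then obtain A B Z where X: "X = A \<times> B \<times> Z" and s: "A \<in> sets N" "B \<in> sets N'" "Z \<in> sets K"
      by blast
    have "X \<subseteq> ?\<Omega>"
      unfolding X space_pair_measure by (intro Sigma_mono sets.sets_into_space s)
    then show "X \<in> Pow ?\<Omega>" by (rule PowI)
  qed
  have "sets (N \<Otimes>\<^sub>M N' \<Otimes>\<^sub>M K) = sets (sigma ?\<Omega> ?E)"
    by (rule sets_pair_eq[where Ca="{space N}" and Cb="{space (N' \<Otimes>\<^sub>M K)}"])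
      (use Eb top sets.space_closed[of N] in \<open>simp_all add: sets.sigma_sets_eq\<close>)
  then have gen: "sets (N \<Otimes>\<^sub>M N' \<Otimes>\<^sub>M K) = sigma_sets ?\<Omega> ?E"
    using E by simp
  show ?thesis
  \<comment> \<open>The full space is itself a box of finite measure, so a constant sequence serves
    as the exhaustion.\<close>
  proof (rule measure_eqI_generator_eq[where E="?E" and \<Omega>="?\<Omega>" and A="\<lambda>_. ?\<Omega>"])
    show "Int_stable ?E"
    proof (rule Int_stableI)
      fix a b assume "a \<in> ?E" "b \<in> ?E"
      then obtain A B Z A' B' Z' where "a = A \<times> B \<times> Z" "b = A' \<times> B' \<times> Z'"
        and s: "A \<in> sets N" "B \<in> sets N'" "Z \<in> sets K" "A' \<in> sets N" "B' \<in> sets N'" "Z' \<in> sets K"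
        by blast
      then have "a \<inter> b = (A \<inter> A') \<times> (B \<inter> B') \<times> (Z \<inter> Z')" by blast
      then show "a \<inter> b \<in> ?E" using s by blast
    qed
    show "emeasure P X = emeasure Q X" if "X \<in> ?E" for X
      using that eq by blast
    show "range (\<lambda>_. ?\<Omega>) \<subseteq> ?E" using top by blast
  qed (use E P(2) Q gen in simp_all)
qed

section \<open>Two conditionally independent views of a binary label\<close>

locale two_views = prob_space M for M :: "'w measure" +
  fixes NS :: "'s measure" and NU :: "'u measure"
    and XS :: "'w \<Rightarrow> 's" and XU :: "'w \<Rightarrow> 'u" and Y :: "'w \<Rightarrow> nat"
  assumes XS [measurable]: "XS \<in> measurable M NS"
    and XU [measurable]: "XU \<in> measurable M NU"
    and Y: "Y \<in> measurable M bit_space"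
    and cond_indep: "cond_indep_rv M NS XS NU XU bit_space Y"
    and dep: "\<not> indep_rv M NS XS bit_space Y"
begin

text \<open>A real-valued factor under the integral, so that restricting to a label class does not
  change the measure and both classes are handled by integrals over \<open>M\<close>.\<close>

definition label_ind :: "nat \<Rightarrow> 'w \<Rightarrow> real" where
  "label_ind y = indicator {\<omega> \<in> space M. Y \<omega> = y}"

definition label_prob :: "nat \<Rightarrow> real" where
  "label_prob y = \<P>(\<omega> in M. Y \<omega> = y)"

abbreviation "pS \<equiv> cond_pr M (sigma_gen M NS XS) (\<lambda>\<omega>. Y \<omega> = 1)"
abbreviation "pU \<equiv> cond_pr M (sigma_gen M NU XU) (\<lambda>\<omega>. Y \<omega> = 1)"

lemma label_cases: "\<omega> \<in> space M \<Longrightarrow> Y \<omega> = 0 \<or> Y \<omega> = 1"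
  using measurable_space[OF Y] by auto

lemma label_sets [measurable]: "{\<omega> \<in> space M. Y \<omega> = y} \<in> sets M"
proof -
  have "{\<omega> \<in> space M. Y \<omega> = y} = {\<omega> \<in> space M. Y \<omega> \<in> {y} \<inter> {0, 1}}"
    using label_cases by auto
  then show ?thesis using sets_measurable_Collect[OF Y, of "{y} \<inter> {0, 1}"] by simp
qed

lemma label_ind_measurable [measurable]: "label_ind y \<in> borel_measurable M"
  by (simp add: label_ind_def)

lemma label_ind_0: "\<omega> \<in> space M \<Longrightarrow> label_ind 0 \<omega> = 1 - label_ind 1 \<omega>"
  using label_cases[of \<omega>] by (auto simp: label_ind_def)

lemma prob_label_split:
  assumes "{\<omega> \<in> space M. P \<omega>} \<in> sets M"
  shows "\<P>(\<omega> in M. P \<omega>) = \<P>(\<omega> in M. P \<omega> \<and> Y \<omega> = 0) + \<P>(\<omega> in M. P \<omega> \<and> Y \<omega> = 1)"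
proof -
  have [measurable]: "{\<omega> \<in> space M. P \<omega> \<and> Y \<omega> = y} \<in> sets M" for y
    by (rule sets.sets_Collect_conj[OF label_sets assms])
  have "{\<omega> \<in> space M. P \<omega>} = {\<omega> \<in> space M. P \<omega> \<and> Y \<omega> = 0} \<union> {\<omega> \<in> space M. P \<omega> \<and> Y \<omega> = 1}"
    using label_cases by auto
  then show ?thesis
    by (subst finite_measure_Union[symmetric]) auto
qed

lemma label_prob_0: "label_prob 0 = 1 - label_prob 1"
  using prob_label_split[of "\<lambda>_. True"] by (simp add: label_prob_def prob_space)

lemma prob_view_label:
  assumes "A \<in> sets NS" "B \<in> sets NU" "y \<in> {0, 1}"
  shows "\<P>(\<omega> in M. XS \<omega> \<in> A \<and> XU \<omega> \<in> B \<and> Y \<omega> = y) * label_prob y =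
         \<P>(\<omega> in M. XS \<omega> \<in> A \<and> Y \<omega> = y) * \<P>(\<omega> in M. XU \<omega> \<in> B \<and> Y \<omega> = y)"
  unfolding label_prob_def
  using assms by (intro cond_indep_on_atom[OF cond_indep XS XU Y]) auto

text \<open>The form in which dependence is used: the set \<open>A\<close> excludes a degenerate
  label, excludes a constant posterior, and gives the nonzero coefficient in the uniqueness
  argument.\<close>

lemma dependent_set:
  obtains A where "A \<in> sets NS"
    "\<P>(\<omega> in M. XS \<omega> \<in> A \<and> Y \<omega> = 1) \<noteq> \<P>(\<omega> in M. XS \<omega> \<in> A) * label_prob 1"
  using indep_rv_bitI[OF XS Y] dep unfolding label_prob_def by blast

text \<open>If \<open>Y = 1\<close> were null, both sides of the inequation for the dependent set
  would be 0; if \<open>Y = 0\<close> were null, both would be the probability that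
  \<open>XS\<close> lies in \<open>A\<close>.\<close>

lemma label_prob_pos: "0 < label_prob y" if "y \<in> {0, 1}"
proof -
  obtain A where A: "A \<in> sets NS"
    "\<P>(\<omega> in M. XS \<omega> \<in> A \<and> Y \<omega> = 1) \<noteq> \<P>(\<omega> in M. XS \<omega> \<in> A) * label_prob 1"
    by (rule dependent_set)
  have XA: "{\<omega> \<in> space M. XS \<omega> \<in> A} \<in> sets M"
    using sets_measurable_Collect[OF XS A(1)] .
  have le: "0 \<le> \<P>(\<omega> in M. XS \<omega> \<in> A \<and> Y \<omega> = y)" "\<P>(\<omega> in M. XS \<omega> \<in> A \<and> Y \<omega> = y) \<le> label_prob y" for y
    unfolding label_prob_def by (auto intro: finite_measure_mono)
  have "label_prob y \<noteq> 0"
  proof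
    assume 0: "label_prob y = 0"
    then have "\<P>(\<omega> in M. XS \<omega> \<in> A \<and> Y \<omega> = y) = 0" using le[of y] by linarith
    moreover from that have "y = 0 \<or> y = 1" by simp
    ultimately show False
      using A(2) 0 prob_label_split[OF XA] label_prob_0 by (elim disjE) simp_all
  qed
  then show ?thesis
    unfolding label_prob_def by (simp add: zero_less_measure_iff)
qed

lemma integral_indicator_label:
  "(\<integral>\<omega>. indicator {\<omega> \<in> space M. P \<omega>} \<omega> * label_ind y \<omega> \<partial>M) = \<P>(\<omega> in M. P \<omega> \<and> Y \<omega> = y)"
  unfolding label_ind_def by (rule integral_indicator_mult_indicator)

section \<open>Factorisation of integrals within a label class\<close>

lemma integrable_bounded:
  assumes "h \<in> borel_measurable M" "AE \<omega> in M. \<bar>h \<omega> :: real\<bar> \<le> 1"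
  shows "integrable M h"
  using assms by (intro integrable_const_bound[where B=1]) auto

lemma integrable_mult_bounded:
  assumes "h \<in> borel_measurable M" "AE \<omega> in M. \<bar>h \<omega> :: real\<bar> \<le> 1"
    and "h' \<in> borel_measurable M" "AE \<omega> in M. \<bar>h' \<omega>\<bar> \<le> 1"
  shows "integrable M (\<lambda>\<omega>. h \<omega> * h' \<omega>)"
proof (rule integrable_bounded)
  show "AE \<omega> in M. \<bar>h \<omega> * h' \<omega>\<bar> \<le> 1"
    using assms(2,4) by eventually_elim (simp add: abs_mult mult_le_one)
qed (use assms in simp)

lemma abs_label_ind: "\<bar>label_ind y \<omega>\<bar> \<le> 1"
  by (simp add: label_ind_def)

text \<open>Rectangles are upgraded to functions one view at a time: first an event for
  \<open>XU\<close> is fixed and \<phi> replaces the indicator for \<open>XS\<close>, then \<phi> is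
  fixed and \<psi> replaces the indicator for \<open>XU\<close>.\<close>

lemma integral_views_label:
  assumes \<phi>: "\<phi> \<in> borel_measurable (sigma_gen M NS XS)" "AE \<omega> in M. \<bar>\<phi> \<omega>\<bar> \<le> 1"
    and \<psi>: "\<psi> \<in> borel_measurable (sigma_gen M NU XU)" "AE \<omega> in M. \<bar>\<psi> \<omega>\<bar> \<le> 1"
    and y: "y \<in> {0, 1}"
  shows "(\<integral>\<omega>. \<phi> \<omega> * \<psi> \<omega> * label_ind y \<omega> \<partial>M) * label_prob y =
         (\<integral>\<omega>. \<phi> \<omega> * label_ind y \<omega> \<partial>M) * (\<integral>\<omega>. \<psi> \<omega> * label_ind y \<omega> \<partial>M)"
proof -
  interpret FS: sigma_finite_subalgebra M "sigma_gen M NS XS"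
    by (rule sigma_finite_subalgebra_sigma_gen[OF XS])
  interpret FU: sigma_finite_subalgebra M "sigma_gen M NU XU"
    by (rule sigma_finite_subalgebra_sigma_gen[OF XU])
  have \<phi>M[measurable]: "\<phi> \<in> borel_measurable M" by (rule measurable_from_subalg[OF FS.subalg \<phi>(1)])
  have \<psi>M[measurable]: "\<psi> \<in> borel_measurable M" by (rule measurable_from_subalg[OF FU.subalg \<psi>(1)])
  have spaces: "XS \<in> space M \<rightarrow> space NS" "XU \<in> space M \<rightarrow> space NU"
    using measurable_space[OF XS] measurable_space[OF XU] by auto
  have il: "integrable M (label_ind y)"
    by (rule integrable_bounded) (simp_all add: abs_label_ind)
  have i\<phi>: "integrable M (\<lambda>\<omega>. \<phi> \<omega> * label_ind y \<omega>)"
    by (rule integrable_mult_bounded) (use \<phi> in \<open>simp_all add: abs_label_ind\<close>)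
  have i\<psi>: "integrable M (\<lambda>\<omega>. \<psi> \<omega> * label_ind y \<omega>)"
    by (rule integrable_mult_bounded) (use \<psi> in \<open>simp_all add: abs_label_ind\<close>)
  \<comment> \<open>The event for \<open>XU\<close> is part of the integrand that is compared with
    \<open>label_ind y\<close>; the constant of proportionality is its probability jointly with
    \<open>Y = y\<close>.\<close>
  have step: "(\<integral>\<omega>. \<phi> \<omega> * (indicator {\<omega> \<in> space M. XU \<omega> \<in> B} \<omega> * label_ind y \<omega> * label_prob y) \<partial>M) =
      \<P>(\<omega> in M. XU \<omega> \<in> B \<and> Y \<omega> = y) * (\<integral>\<omega>. \<phi> \<omega> * label_ind y \<omega> \<partial>M)" if B: "B \<in> sets NU" for B
  proof (rule FS.integral_mult_proportional)
    have b[measurable]: "{\<omega> \<in> space M. XU \<omega> \<in> B} \<in> sets M"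
      using sets_measurable_Collect[OF XU B] .
    have ib: "integrable M (\<lambda>\<omega>. indicator {\<omega> \<in> space M. XU \<omega> \<in> B} \<omega> * h \<omega> * label_prob y)"
      if "integrable M h" for h :: "'w \<Rightarrow> real"
      using integrable_mult_indicator[OF b that] by (simp add: mult.commute)
    show "integrable M (\<lambda>\<omega>. indicator {\<omega> \<in> space M. XU \<omega> \<in> B} \<omega> * label_ind y \<omega> * label_prob y)"
      by (rule ib[OF il])
    show "integrable M (\<lambda>\<omega>. \<phi> \<omega> * (indicator {\<omega> \<in> space M. XU \<omega> \<in> B} \<omega> * label_ind y \<omega> * label_prob y))"
      using ib[OF i\<phi>] by (simp add: mult_ac)
    fix a assume "a \<in> sets (sigma_gen M NS XS)"
    then obtain A where A: "A \<in> sets NS" "a = {\<omega> \<in> space M. XS \<omega> \<in> A}"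
      unfolding sets_sigma_gen[OF spaces(1)] by blast
    have "(\<integral>\<omega>. indicator a \<omega> * (indicator {\<omega> \<in> space M. XU \<omega> \<in> B} \<omega> * label_ind y \<omega> * label_prob y) \<partial>M) =
        (\<integral>\<omega>. indicator {\<omega> \<in> space M. XS \<omega> \<in> A \<and> XU \<omega> \<in> B} \<omega> * label_ind y \<omega> * label_prob y \<partial>M)"
      unfolding A(2) by (intro Bochner_Integration.integral_cong) (auto split: split_indicator)
    also have "\<dots> = \<P>(\<omega> in M. XS \<omega> \<in> A \<and> XU \<omega> \<in> B \<and> Y \<omega> = y) * label_prob y"
      by (simp add: integral_indicator_label conj_assoc)
    finally show "(\<integral>\<omega>. indicator a \<omega> * (indicator {\<omega> \<in> space M. XU \<omega> \<in> B} \<omega> * label_ind y \<omega> * label_prob y) \<partial>M) =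
        \<P>(\<omega> in M. XU \<omega> \<in> B \<and> Y \<omega> = y) * (\<integral>\<omega>. indicator a \<omega> * label_ind y \<omega> \<partial>M)"
      unfolding prob_view_label[OF A(1) B y] A(2) integral_indicator_label by (simp only: mult.commute)
  qed (use il i\<phi> \<phi> in simp_all)
  \<comment> \<open>Now \<phi> is part of the integrand and the constant is its integral over the
    class; \<open>step\<close> supplies the hypothesis on indicators.\<close>
  have "(\<integral>\<omega>. \<psi> \<omega> * (\<phi> \<omega> * label_ind y \<omega> * label_prob y) \<partial>M) =
      (\<integral>\<omega>. \<phi> \<omega> * label_ind y \<omega> \<partial>M) * (\<integral>\<omega>. \<psi> \<omega> * label_ind y \<omega> \<partial>M)"
  proof (rule FU.integral_mult_proportional)
    show "integrable M (\<lambda>\<omega>. \<phi> \<omega> * label_ind y \<omega> * label_prob y)"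
      using i\<phi> by simp
    have "integrable M (\<lambda>\<omega>. \<phi> \<omega> * (\<psi> \<omega> * label_ind y \<omega>))"
    proof (rule integrable_mult_bounded)
      show "AE \<omega> in M. \<bar>\<psi> \<omega> * label_ind y \<omega>\<bar> \<le> 1"
        using \<psi>(2) by eventually_elim (simp add: abs_mult mult_le_one abs_label_ind)
    qed (use \<phi> in simp_all)
    then have "integrable M (\<lambda>\<omega>. label_prob y * (\<phi> \<omega> * (\<psi> \<omega> * label_ind y \<omega>)))"
      by simp
    then show "integrable M (\<lambda>\<omega>. \<psi> \<omega> * (\<phi> \<omega> * label_ind y \<omega> * label_prob y))"
      by (simp only: mult_ac)
    fix b assume "b \<in> sets (sigma_gen M NU XU)"
    then obtain B where B: "B \<in> sets NU" "b = {\<omega> \<in> space M. XU \<omega> \<in> B}"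
      unfolding sets_sigma_gen[OF spaces(2)] by blast
    show "(\<integral>\<omega>. indicator b \<omega> * (\<phi> \<omega> * label_ind y \<omega> * label_prob y) \<partial>M) =
        (\<integral>\<omega>. \<phi> \<omega> * label_ind y \<omega> \<partial>M) * (\<integral>\<omega>. indicator b \<omega> * label_ind y \<omega> \<partial>M)"
      using step[OF B(1)] unfolding B(2) integral_indicator_label by (simp add: mult_ac)
  qed (use il i\<psi> \<psi> in simp_all)
  moreover have "(\<integral>\<omega>. \<psi> \<omega> * (\<phi> \<omega> * label_ind y \<omega> * label_prob y) \<partial>M) =
      (\<integral>\<omega>. \<phi> \<omega> * \<psi> \<omega> * label_ind y \<omega> * label_prob y \<partial>M)"
    by (simp only: mult_ac)
  ultimately show ?thesis by (simp only: integral_mult_left_zero)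
qed

lemma AE_abs_cond_pr:
  assumes "X \<in> measurable M N" "{\<omega> \<in> space M. P \<omega>} \<in> sets M"
  shows "AE \<omega> in M. \<bar>cond_pr M (sigma_gen M N X) P \<omega>\<bar> \<le> 1"
    "AE \<omega> in M. \<bar>1 - cond_pr M (sigma_gen M N X) P \<omega>\<bar> \<le> 1"
  by (rule AE_mp[OF AE_cond_pr_bounds[OF assms]], simp)+

text \<open>Turns the class-restricted integrals produced by \<open>integral_views_label\<close>
  into integrals involving one view and its posterior only. The case of label 0 is the complement of
  the case of label 1.\<close>

lemma integral_mult_label:
  assumes X: "X \<in> measurable M N"
    and \<phi>: "\<phi> \<in> borel_measurable (sigma_gen M N X)" "AE \<omega> in M. \<bar>\<phi> \<omega>\<bar> \<le> 1"
  shows "(\<integral>\<omega>. \<phi> \<omega> * label_ind 1 \<omega> \<partial>M) = (\<integral>\<omega>. \<phi> \<omega> * cond_pr M (sigma_gen M N X) (\<lambda>\<omega>. Y \<omega> = 1) \<omega> \<partial>M)"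
      (is ?one)
    and "(\<integral>\<omega>. \<phi> \<omega> * label_ind 0 \<omega> \<partial>M) = (\<integral>\<omega>. \<phi> \<omega> * (1 - cond_pr M (sigma_gen M N X) (\<lambda>\<omega>. Y \<omega> = 1) \<omega>) \<partial>M)"
proof -
  let ?c = "cond_pr M (sigma_gen M N X) (\<lambda>\<omega>. Y \<omega> = 1)"
  have [measurable]: "\<phi> \<in> borel_measurable M"
    by (rule measurable_from_subalg[OF subalgebra_sigma_gen[OF X] \<phi>(1)])
  show one: ?one
    unfolding label_ind_def by (rule integral_cond_pr[OF X label_sets \<phi>, symmetric])
  have i: "integrable M \<phi>" by (rule integrable_bounded) (use \<phi> in simp_all)
  have i1: "integrable M (\<lambda>\<omega>. \<phi> \<omega> * label_ind 1 \<omega>)"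
    by (rule integrable_mult_bounded) (use \<phi> in \<open>simp_all add: abs_label_ind\<close>)
  have ic: "integrable M (\<lambda>\<omega>. \<phi> \<omega> * ?c \<omega>)"
    by (rule integrable_mult_bounded) (use \<phi> AE_abs_cond_pr[OF X label_sets] in simp_all)
  have "(\<integral>\<omega>. \<phi> \<omega> * label_ind 0 \<omega> \<partial>M) = (\<integral>\<omega>. \<phi> \<omega> - \<phi> \<omega> * label_ind 1 \<omega> \<partial>M)"
    by (intro Bochner_Integration.integral_cong) (simp_all only: label_ind_0 right_diff_distrib mult_1_right)
  also have "\<dots> = (\<integral>\<omega>. \<phi> \<omega> \<partial>M) - (\<integral>\<omega>. \<phi> \<omega> * ?c \<omega> \<partial>M)"
    unfolding one[symmetric] by (rule Bochner_Integration.integral_diff[OF i i1])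
  also have "\<dots> = (\<integral>\<omega>. \<phi> \<omega> * (1 - ?c \<omega>) \<partial>M)"
    unfolding right_diff_distrib mult_1_right by (rule Bochner_Integration.integral_diff[OF i ic, symmetric])
  finally show "(\<integral>\<omega>. \<phi> \<omega> * label_ind 0 \<omega> \<partial>M) = (\<integral>\<omega>. \<phi> \<omega> * (1 - ?c \<omega>) \<partial>M)" .
qed

text \<open>Test the posterior against the event where it is 0, respectively its complement to 1
  against the event where it is 1: the integrand vanishes, hence so does the probability of the
  contradicting label.\<close>

lemma AE_label_determined:
  assumes X: "X \<in> measurable M N"
  shows "AE \<omega> in M. cond_pr M (sigma_gen M N X) (\<lambda>\<omega>. Y \<omega> = 1) \<omega> = 0 \<longrightarrow> Y \<omega> = 0"
    and "AE \<omega> in M. cond_pr M (sigma_gen M N X) (\<lambda>\<omega>. Y \<omega> = 1) \<omega> = 1 \<longrightarrow> Y \<omega> = 1"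
proof -
  let ?c = "cond_pr M (sigma_gen M N X) (\<lambda>\<omega>. Y \<omega> = 1)"
  have c: "?c \<in> borel_measurable (sigma_gen M N X)" by simp
  have I: "indicator {\<omega> \<in> space M. ?c \<omega> = t} \<in> borel_measurable (sigma_gen M N X)" for t :: real
    using measurable_sets[OF c, of "{t}"]
    by (intro borel_measurable_indicator) (simp add: vimage_def Int_def conj_commute)
  have meas: "{\<omega> \<in> space M. ?c \<omega> = t \<and> Y \<omega> = y} \<in> sets M" for t y
    by (intro sets.sets_Collect_conj label_sets) simp
  have "\<P>(\<omega> in M. ?c \<omega> = 0 \<and> Y \<omega> = 1) = (\<integral>\<omega>. indicator {\<omega> \<in> space M. ?c \<omega> = 0} \<omega> * ?c \<omega> \<partial>M)"
    using integral_mult_label(1)[OF X I] by (simp add: integral_indicator_label)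
  also have "\<dots> = (\<integral>\<omega>. 0 \<partial>M)"
    by (intro Bochner_Integration.integral_cong) (auto split: split_indicator)
  finally have "AE \<omega> in M. \<not> (?c \<omega> = 0 \<and> Y \<omega> = 1)"
    using prob_Collect_eq_0[OF meas, of 0 1] by simp
  then show "AE \<omega> in M. ?c \<omega> = 0 \<longrightarrow> Y \<omega> = 0"
    using AE_space by eventually_elim (use label_cases in blast)
  have "\<P>(\<omega> in M. ?c \<omega> = 1 \<and> Y \<omega> = 0) = (\<integral>\<omega>. indicator {\<omega> \<in> space M. ?c \<omega> = 1} \<omega> * (1 - ?c \<omega>) \<partial>M)"
    using integral_mult_label(2)[OF X I] by (simp add: integral_indicator_label)
  also have "\<dots> = (\<integral>\<omega>. 0 \<partial>M)"
    by (intro Bochner_Integration.integral_cong) (auto split: split_indicator)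
  finally have "AE \<omega> in M. \<not> (?c \<omega> = 1 \<and> Y \<omega> = 0)"
    using prob_Collect_eq_0[OF meas, of 1 0] by simp
  then show "AE \<omega> in M. ?c \<omega> = 1 \<longrightarrow> Y \<omega> = 1"
    using AE_space by eventually_elim (use label_cases in blast)
qed

end

lemma admissible_triple_iff_two_views:
  "admissible_triple M NS NU XS XU Y \<longleftrightarrow> two_views M NS NU XS XU Y"
  by (auto simp: admissible_triple_def two_views_def two_views_axioms_def)

section \<open>The posterior given both views\<close>

text \<open>On finite log-odds the sigmoid is odds / (odds + 1), and adding logits multiplies odds.
  If one of \<open>s\<close>, \<open>u\<close> is 0, the other is not 1, so the sum is minus
  infinity and the right-hand numerator is 0; the value 1 is symmetric, with the second summand of
  the denominator vanishing.\<close>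

lemma sigmoid_logit_combine:
  assumes s: "0 \<le> s" "s \<le> 1" and u: "0 \<le> u" "u \<le> 1" and q: "0 < q" "q < 1"
    and "\<not> (s = 1 \<and> u = 0)" "\<not> (s = 0 \<and> u = 1)"
  shows "sigmoid (logit s + logit u - logit q) =
    (s * u / q) / (s * u / q + (1 - s) * (1 - u) / (1 - q))"
proof -
  consider "s = 0 \<or> u = 0" | "s = 1 \<or> u = 1" | "0 < s" "s < 1" "0 < u" "u < 1"
    using s u by force
  then show ?thesis
  proof cases
    case 1
    then show ?thesis
      using assms by (auto simp: logit_def sigmoid_def)
  next
    case 2
    then show ?thesis
      using assms by (auto simp: logit_def sigmoid_def)
  next
    case 3
    let ?t = "ln (s / (1 - s)) + ln (u / (1 - u)) - ln (q / (1 - q))"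
    have "exp ?t = (s / (1 - s)) * (u / (1 - u)) / (q / (1 - q))"
      using 3 q by (simp add: exp_add exp_diff)
    moreover have "1 / (1 + exp (- ?t)) = exp ?t / (exp ?t + 1)"
      unfolding exp_minus by (simp add: field_simps add_pos_pos)
    moreover have "sigmoid (logit s + logit u - logit q) = 1 / (1 + exp (- ?t))"
      using 3 q by (simp add: logit_def sigmoid_def)
    moreover have "x / (x + y) = (x / y) / (x / y + 1)" if "0 < y" "0 < x" for x y :: real
      using that by (simp add: field_simps add_pos_pos)
    \<comment> \<open>The two instances are the unnormalised weights of label 0 and label 1; their
      quotient is the combined odds.\<close>
    from this[of "(1 - s) * (1 - u) / (1 - q)" "s * u / q"]
    have "(s * u / q) / (s * u / q + (1 - s) * (1 - u) / (1 - q)) =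
        (s / (1 - s)) * (u / (1 - u)) / (q / (1 - q)) /
        ((s / (1 - s)) * (u / (1 - u)) / (q / (1 - q)) + 1)"
      using 3 q by (simp add: ac_simps)
    ultimately show ?thesis by simp
  qed
qed

context two_views
begin

lemma pS_meas: "pS \<in> borel_measurable (sigma_gen M NS XS)" by simp
lemma pU_meas: "pU \<in> borel_measurable (sigma_gen M NU XU)" by simp

lemma AE_pS_pU: "AE \<omega> in M. 0 \<le> pS \<omega> \<and> pS \<omega> \<le> 1 \<and> 0 \<le> pU \<omega> \<and> pU \<omega> \<le> 1"
  using AE_cond_pr_bounds[OF XS label_sets[of 1]] AE_cond_pr_bounds[OF XU label_sets[of 1]]
  by eventually_elim simp

text \<open>\<open>view_density1\<close> and \<open>view_density - view_density1\<close> are the densities, with respect to the product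
  of the two marginal laws, of the joint law of the views on \<open>Y = 1\<close> and on \<open>Y = 0\<close>.\<close>

definition view_density1 :: "'w \<Rightarrow> real" where
  "view_density1 \<omega> = pS \<omega> * pU \<omega> / label_prob 1"

definition view_density :: "'w \<Rightarrow> real" where
  "view_density \<omega> = view_density1 \<omega> + (1 - pS \<omega>) * (1 - pU \<omega>) / label_prob 0"

abbreviation "both_views \<equiv> sigma_gen M (NS \<Otimes>\<^sub>M NU) (\<lambda>\<omega>. (XS \<omega>, XU \<omega>))"

lemma views_pair [measurable]: "(\<lambda>\<omega>. (XS \<omega>, XU \<omega>)) \<in> measurable M (NS \<Otimes>\<^sub>M NU)"
  by measurable

text \<open>Each posterior depends on one view and is therefore measurable for the pair. This is
  what later allows \<open>view_density\<close> to be taken out of the conditional expectation given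
  both views.\<close>

lemma view_density_both_views [measurable]:
  "view_density1 \<in> borel_measurable both_views" "view_density \<in> borel_measurable both_views"
proof -
  have sp: "(\<lambda>\<omega>. (XS \<omega>, XU \<omega>)) \<in> space M \<rightarrow> space (NS \<Otimes>\<^sub>M NU)"
    using measurable_space[OF views_pair] by auto
  have "XS \<in> measurable both_views NS"
    by (rule measurable_sigma_gen[OF sp XS measurable_fst]) simp
  then have "subalgebra both_views (sigma_gen M NS XS)"
    using sets_image_in_sets[of both_views "space M" XS NS]
    unfolding subalgebra_def by (simp add: sigma_gen_def)
  then have [measurable]: "pS \<in> borel_measurable both_views"
    using pS_meas by (rule measurable_from_subalg)
  have "XU \<in> measurable both_views NU"
    by (rule measurable_sigma_gen[OF sp XU measurable_snd]) simp
  then have "subalgebra both_views (sigma_gen M NU XU)"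
    using sets_image_in_sets[of both_views "space M" XU NU]
    unfolding subalgebra_def by (simp add: sigma_gen_def)
  then have [measurable]: "pU \<in> borel_measurable both_views"
    using pU_meas by (rule measurable_from_subalg)
  show "view_density1 \<in> borel_measurable both_views" "view_density \<in> borel_measurable both_views"
    unfolding view_density_def[abs_def] view_density1_def[abs_def] by measurable
qed

lemma view_density_measurable [measurable]:
  "view_density1 \<in> borel_measurable M" "view_density \<in> borel_measurable M"
  using view_density_both_views subalgebra_sigma_gen[OF views_pair]
  by (blast intro: measurable_from_subalg)+

lemma integrable_view_density: "integrable M view_density1" "integrable M view_density"
proof -
  have pS: "AE \<omega> in M. \<bar>pS \<omega>\<bar> \<le> 1" "AE \<omega> in M. \<bar>1 - pS \<omega>\<bar> \<le> 1"
    by (rule AE_abs_cond_pr[OF XS label_sets])+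
  have pU: "AE \<omega> in M. \<bar>pU \<omega>\<bar> \<le> 1" "AE \<omega> in M. \<bar>1 - pU \<omega>\<bar> \<le> 1"
    by (rule AE_abs_cond_pr[OF XU label_sets])+
  have "integrable M (\<lambda>\<omega>. pS \<omega> * pU \<omega>)" "integrable M (\<lambda>\<omega>. (1 - pS \<omega>) * (1 - pU \<omega>))"
    by (rule integrable_mult_bounded; (rule pS pU | measurable))+
  then show "integrable M view_density1" "integrable M view_density"
    unfolding view_density_def[abs_def] view_density1_def[abs_def] by auto
qed

text \<open>The core computation. Cancelling f g / p on \<open>Y = 1\<close> leaves a term supported
  on \<open>Y = 1\<close> and a term supported on \<open>Y = 0\<close>, and conditional independence
  gives both the same integral.\<close>

lemma integral_rectangle_view_density:
  assumes A: "A \<in> sets NS" and B: "B \<in> sets NU"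
  shows "(\<integral>\<omega>\<in>{\<omega> \<in> space M. XS \<omega> \<in> A \<and> XU \<omega> \<in> B}.
    view_density \<omega> * label_ind 1 \<omega> - view_density1 \<omega> \<partial>M) = 0"
proof -
  let ?a = "indicator {\<omega> \<in> space M. XS \<omega> \<in> A} :: 'w \<Rightarrow> real"
  let ?b = "indicator {\<omega> \<in> space M. XU \<omega> \<in> B} :: 'w \<Rightarrow> real"
  let ?p = "label_prob 1" and ?q = "label_prob 0"
  have pq: "0 < ?p" "0 < ?q" by (rule label_prob_pos; simp)+
  have "{\<omega> \<in> space M. XS \<omega> \<in> A} \<in> sets (sigma_gen M NS XS)"
    using A measurable_space[OF XS] by (subst sets_sigma_gen) auto
  then have a[measurable]: "?a \<in> borel_measurable (sigma_gen M NS XS)" by simp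
  have "{\<omega> \<in> space M. XU \<omega> \<in> B} \<in> sets (sigma_gen M NU XU)"
    using B measurable_space[OF XU] by (subst sets_sigma_gen) auto
  then have b[measurable]: "?b \<in> borel_measurable (sigma_gen M NU XU)" by simp
  have S: "(\<lambda>\<omega>. ?a \<omega> * pS \<omega>) \<in> borel_measurable (sigma_gen M NS XS)"
      "AE \<omega> in M. \<bar>?a \<omega> * pS \<omega>\<bar> \<le> 1"
    and S': "(\<lambda>\<omega>. ?a \<omega> * (1 - pS \<omega>)) \<in> borel_measurable (sigma_gen M NS XS)"
      "AE \<omega> in M. \<bar>?a \<omega> * (1 - pS \<omega>)\<bar> \<le> 1"
    by (measurable, rule AE_mp[OF AE_pS_pU], simp split: split_indicator)+
  have U: "(\<lambda>\<omega>. ?b \<omega> * pU \<omega>) \<in> borel_measurable (sigma_gen M NU XU)"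
      "AE \<omega> in M. \<bar>?b \<omega> * pU \<omega>\<bar> \<le> 1"
    and U': "(\<lambda>\<omega>. ?b \<omega> * (1 - pU \<omega>)) \<in> borel_measurable (sigma_gen M NU XU)"
      "AE \<omega> in M. \<bar>?b \<omega> * (1 - pU \<omega>)\<bar> \<le> 1"
    by (measurable, rule AE_mp[OF AE_pS_pU], simp split: split_indicator)+
  note toM = measurable_from_subalg[OF subalgebra_sigma_gen[OF XS]]
    measurable_from_subalg[OF subalgebra_sigma_gen[OF XU]]
  define F where "F y = (\<integral>\<omega>. (?a \<omega> * pS \<omega>) * (?b \<omega> * pU \<omega>) * label_ind y \<omega> \<partial>M)" for y
  define G where "G = (\<integral>\<omega>. (?a \<omega> * (1 - pS \<omega>)) * (?b \<omega> * (1 - pU \<omega>)) * label_ind 1 \<omega> \<partial>M)"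
  have bound3: "integrable M (\<lambda>\<omega>. \<phi> \<omega> * \<psi> \<omega> * label_ind y \<omega>)"
    if "\<phi> \<in> borel_measurable M" "AE \<omega> in M. \<bar>\<phi> \<omega>\<bar> \<le> 1"
      "\<psi> \<in> borel_measurable M" "AE \<omega> in M. \<bar>\<psi> \<omega>\<bar> \<le> 1" for \<phi> \<psi> :: "'w \<Rightarrow> real" and y
  proof (rule integrable_bounded)
    show "AE \<omega> in M. \<bar>\<phi> \<omega> * \<psi> \<omega> * label_ind y \<omega>\<bar> \<le> 1"
      using that(2,4) by eventually_elim (simp add: abs_mult mult_le_one abs_label_ind)
  qed (use that in measurable)
  have iF: "integrable M (\<lambda>\<omega>. (?a \<omega> * pS \<omega>) * (?b \<omega> * pU \<omega>) * label_ind y \<omega>)" for y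
    by (rule bound3[OF toM(1)[OF S(1)] S(2) toM(2)[OF U(1)] U(2)])
  have iG: "integrable M (\<lambda>\<omega>. (?a \<omega> * (1 - pS \<omega>)) * (?b \<omega> * (1 - pU \<omega>)) * label_ind 1 \<omega>)"
    by (rule bound3[OF toM(1)[OF S'(1)] S'(2) toM(2)[OF U'(1)] U'(2)])
  \<comment> \<open>Within \<open>Y = 1\<close> the missing factors \<open>pS\<close> and
    \<open>pU\<close> appear; within \<open>Y = 0\<close>, starting from \<open>pS\<close> and
    \<open>pU\<close>, their complements appear. The two products agree up to order.\<close>
  have "G * ?p = (\<integral>\<omega>. (?a \<omega> * (1 - pS \<omega>)) * pS \<omega> \<partial>M) * (\<integral>\<omega>. (?b \<omega> * (1 - pU \<omega>)) * pU \<omega> \<partial>M)"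
    unfolding G_def using integral_views_label[OF S' U', of 1]
      integral_mult_label(1)[OF XS S'] integral_mult_label(1)[OF XU U'] by simp
  moreover have "F 0 * ?q = (\<integral>\<omega>. (?a \<omega> * pS \<omega>) * (1 - pS \<omega>) \<partial>M) * (\<integral>\<omega>. (?b \<omega> * pU \<omega>) * (1 - pU \<omega>) \<partial>M)"
    unfolding F_def using integral_views_label[OF S U, of 0]
      integral_mult_label(2)[OF XS S] integral_mult_label(2)[OF XU U] by simp
  ultimately have swap: "G * ?p = F 0 * ?q"
    by (simp add: mult_ac)
  have "(\<integral>\<omega>\<in>{\<omega> \<in> space M. XS \<omega> \<in> A \<and> XU \<omega> \<in> B}.
      view_density \<omega> * label_ind 1 \<omega> - view_density1 \<omega> \<partial>M) =
    (\<integral>\<omega>. (?a \<omega> * (1 - pS \<omega>)) * (?b \<omega> * (1 - pU \<omega>)) * label_ind 1 \<omega> / ?q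
      - (?a \<omega> * pS \<omega>) * (?b \<omega> * pU \<omega>) * label_ind 0 \<omega> / ?p \<partial>M)"
    unfolding set_lebesgue_integral_def
  proof (intro Bochner_Integration.integral_cong refl)
    fix \<omega> assume \<omega>: "\<omega> \<in> space M"
    have ab: "indicator {\<omega> \<in> space M. XS \<omega> \<in> A \<and> XU \<omega> \<in> B} \<omega> = ?a \<omega> * ?b \<omega>"
      by (simp split: split_indicator)
    show "indicator {\<omega> \<in> space M. XS \<omega> \<in> A \<and> XU \<omega> \<in> B} \<omega> *\<^sub>R
        (view_density \<omega> * label_ind 1 \<omega> - view_density1 \<omega>) =
      (?a \<omega> * (1 - pS \<omega>)) * (?b \<omega> * (1 - pU \<omega>)) * label_ind 1 \<omega> / ?q
      - (?a \<omega> * pS \<omega>) * (?b \<omega> * pU \<omega>) * label_ind 0 \<omega> / ?p"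
      unfolding ab label_ind_0[OF \<omega>] view_density_def view_density1_def using pq
      by (simp add: field_simps del: One_nat_def)
  qed
  also have "\<dots> = G / ?q - F 0 / ?p"
    unfolding F_def G_def using iG iF[of 0] by simp
  also have "\<dots> = 0"
    using swap pq by (simp add: field_simps)
  finally show ?thesis .
qed

text \<open>The vanishing integrals identify \<open>view_density1\<close> as the conditional
  expectation of \<open>view_density * label_ind 1\<close> given both views, and the measurable
  factor \<open>view_density\<close> comes out. It is not divided by, since it could still be 0 at
  this point.\<close>

lemma posterior_both_views:
  "AE \<omega> in M. view_density \<omega> * cond_pr M both_views (\<lambda>\<omega>. Y \<omega> = 1) \<omega> = view_density1 \<omega>"
proof -
  interpret F: sigma_finite_subalgebra M both_views
    by (rule sigma_finite_subalgebra_sigma_gen[OF views_pair])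
  have i: "integrable M (\<lambda>\<omega>. view_density \<omega> * label_ind 1 \<omega>)"
    using integrable_mult_indicator[OF label_sets integrable_view_density(2), of 1]
    by (simp add: label_ind_def mult.commute)
  have "AE \<omega> in M. real_cond_exp M both_views (\<lambda>\<omega>. view_density \<omega> * label_ind 1 \<omega>) \<omega> = view_density1 \<omega>"
  proof (rule F.real_cond_exp_charact[OF _ i integrable_view_density(1) view_density_both_views(1)])
    fix C assume C: "C \<in> sets both_views"
    then have CM: "C \<in> sets M" using F.subalg by (auto simp: subalgebra_def)
    have "(\<integral>\<omega>\<in>C. view_density \<omega> * label_ind 1 \<omega> - view_density1 \<omega> \<partial>M) = 0"
      by (rule set_integral_eq_0_generated_by_pair[OF XS XU _ integral_rectangle_view_density C])
        (use i integrable_view_density(1) in simp_all)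
    moreover have "(\<integral>\<omega>\<in>C. view_density \<omega> * label_ind 1 \<omega> - view_density1 \<omega> \<partial>M) =
        (\<integral>\<omega>\<in>C. view_density \<omega> * label_ind 1 \<omega> \<partial>M) - (\<integral>\<omega>\<in>C. view_density1 \<omega> \<partial>M)"
      unfolding set_integrable_def
      by (rule set_integral_diff(2))
        (use integrable_mult_indicator[OF CM i] integrable_mult_indicator[OF CM integrable_view_density(1)]
          in \<open>simp_all add: set_integrable_def\<close>)
    ultimately show "(\<integral>\<omega>\<in>C. view_density \<omega> * label_ind 1 \<omega> \<partial>M) = (\<integral>\<omega>\<in>C. view_density1 \<omega> \<partial>M)"
      by simp
  qed
  with F.real_cond_exp_mult[OF view_density_both_views(2) label_ind_measurable i] show ?thesis
    by eventually_elim (simp add: cond_pr_def label_ind_def)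
qed

lemma sigmoid_both_views:
  "AE \<omega> in M.
     \<not> (logit (pS \<omega>) = \<infinity> \<and> logit (pU \<omega>) = -\<infinity>) \<and> \<not> (logit (pS \<omega>) = -\<infinity> \<and> logit (pU \<omega>) = \<infinity>) \<and>
     cond_pr M both_views (\<lambda>\<omega>. Y \<omega> = 1) \<omega> =
       sigmoid (logit (pS \<omega>) + logit (pU \<omega>) - logit \<P>(\<omega> in M. Y \<omega> = 1))"
  using AE_pS_pU posterior_both_views AE_label_determined[OF XS] AE_label_determined[OF XU]
proof eventually_elim
  case (elim \<omega>)
  have pq: "0 < label_prob 1" "label_prob 1 < 1" "0 < label_prob 0"
    using label_prob_pos[of 0] label_prob_pos[of 1] label_prob_0 by auto
  \<comment> \<open>Opposite extreme posteriors would force \<open>Y\<close> to be 0 and 1 at the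
    same point.\<close>
  have deg: "\<not> (pS \<omega> = 1 \<and> pU \<omega> = 0)" "\<not> (pS \<omega> = 0 \<and> pU \<omega> = 1)"
    using elim by auto
  have inf: "logit t = \<infinity> \<longleftrightarrow> t = 1" "logit t = -\<infinity> \<longleftrightarrow> t = 0" for t
    by (simp_all add: logit_def)
  \<comment> \<open>Both summands are nonnegative, so a zero needs one posterior to be 0 and the
    other to be 1.\<close>
  have "view_density \<omega> \<noteq> 0"
  proof
    assume "view_density \<omega> = 0"
    moreover have "0 \<le> pS \<omega> * pU \<omega> / label_prob 1" "0 \<le> (1 - pS \<omega>) * (1 - pU \<omega>) / label_prob 0"
      using elim pq by simp_all
    ultimately have "pS \<omega> * pU \<omega> / label_prob 1 = 0" "(1 - pS \<omega>) * (1 - pU \<omega>) / label_prob 0 = 0"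
      unfolding view_density_def view_density1_def by linarith+
    then show False
      using deg pq by auto
  qed
  then have "cond_pr M both_views (\<lambda>\<omega>. Y \<omega> = 1) \<omega> = view_density1 \<omega> / view_density \<omega>"
    using elim by (simp add: field_simps)
  also have "\<dots> = sigmoid (logit (pS \<omega>) + logit (pU \<omega>) - logit (label_prob 1))"
    unfolding view_density_def view_density1_def label_prob_0
    by (rule sigmoid_logit_combine[symmetric]) (use elim pq deg in auto)
  finally show ?case
    using deg unfolding inf label_prob_def by simp
qed

end

section \<open>Pseudo-labels\<close>

context two_views
begin

text \<open>Introduced before any pseudo-label is fixed: both accuracies are functions of this
  number and the label probabilities, whichever \<open>Yh\<close> is drawn.\<close>

definition pS_moment :: real where
  "pS_moment = (\<integral>\<omega>. pS \<omega> * pS \<omega> \<partial>M)"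

lemma AE_abs_pS: "AE \<omega> in M. \<bar>pS \<omega>\<bar> \<le> 1"
  by (rule AE_abs_cond_pr(1)[OF XS label_sets])

lemma integrable_pS: "integrable M pS"
  by (rule integrable_bounded[OF cond_pr_measurable(2) AE_abs_pS])

lemma integral_pS_label:
  "(\<integral>\<omega>. pS \<omega> \<partial>M) = label_prob 1"
  "(\<integral>\<omega>. pS \<omega> * label_ind 1 \<omega> \<partial>M) = pS_moment"
  "(\<integral>\<omega>. pS \<omega> * label_ind 0 \<omega> \<partial>M) = label_prob 1 - pS_moment"
proof -
  show int: "(\<integral>\<omega>. pS \<omega> \<partial>M) = label_prob 1"
    using integral_mult_label(1)[OF XS, of "\<lambda>_. 1"]
    by (simp add: label_ind_def label_prob_def Int_def conj_ac)
  show "(\<integral>\<omega>. pS \<omega> * label_ind 1 \<omega> \<partial>M) = pS_moment"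
    unfolding pS_moment_def by (rule integral_mult_label(1)[OF XS pS_meas AE_abs_pS])
  have "integrable M (\<lambda>\<omega>. pS \<omega> * pS \<omega>)"
    by (rule integrable_mult_bounded[OF cond_pr_measurable(2) AE_abs_pS cond_pr_measurable(2) AE_abs_pS])
  then have "(\<integral>\<omega>. pS \<omega> * (1 - pS \<omega>) \<partial>M) = label_prob 1 - pS_moment"
    unfolding pS_moment_def int[symmetric] right_diff_distrib mult_1_right
    by (rule Bochner_Integration.integral_diff[OF integrable_pS])
  then show "(\<integral>\<omega>. pS \<omega> * label_ind 0 \<omega> \<partial>M) = label_prob 1 - pS_moment"
    using integral_mult_label(2)[OF XS pS_meas AE_abs_pS] by (rule trans[rotated])
qed

text \<open>A constant \<open>pS\<close> would make \<open>XS\<close> and \<open>Y\<close> independent.\<close>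

lemma pS_moment_gt: "label_prob 1 * label_prob 1 < pS_moment"
proof -
  let ?p = "label_prob 1"
  let ?v = "\<lambda>\<omega>. (pS \<omega> - ?p) * (pS \<omega> - ?p)"
  have i2: "integrable M (\<lambda>\<omega>. pS \<omega> * pS \<omega>)"
    by (rule integrable_mult_bounded[OF cond_pr_measurable(2) AE_abs_pS cond_pr_measurable(2) AE_abs_pS])
  have v: "?v = (\<lambda>\<omega>. pS \<omega> * pS \<omega> - 2 * ?p * pS \<omega> + ?p * ?p)"
    by (rule ext) (simp add: algebra_simps)
  have iv: "integrable M ?v"
    unfolding v using i2 integrable_pS by simp
  have Ev: "(\<integral>\<omega>. ?v \<omega> \<partial>M) = pS_moment - ?p * ?p"
    unfolding v using i2 integrable_pS integral_pS_label(1)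
    by (simp add: pS_moment_def prob_space)
  have "(\<integral>\<omega>. ?v \<omega> \<partial>M) \<noteq> 0"
  proof
    assume "(\<integral>\<omega>. ?v \<omega> \<partial>M) = 0"
    then have const: "AE \<omega> in M. pS \<omega> = ?p"
      using integral_nonneg_eq_0_iff_AE[OF iv] by simp
    obtain A where A: "A \<in> sets NS"
      "\<P>(\<omega> in M. XS \<omega> \<in> A \<and> Y \<omega> = 1) \<noteq> \<P>(\<omega> in M. XS \<omega> \<in> A) * ?p"
      by (rule dependent_set)
    let ?a = "indicator {\<omega> \<in> space M. XS \<omega> \<in> A} :: 'w \<Rightarrow> real"
    have AM[measurable]: "{\<omega> \<in> space M. XS \<omega> \<in> A} \<in> sets M"
      by (rule sets_measurable_Collect[OF XS A(1)])
    have "{\<omega> \<in> space M. XS \<omega> \<in> A} \<in> sets (sigma_gen M NS XS)"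
      using A(1) measurable_space[OF XS] by (subst sets_sigma_gen) auto
    then have a: "?a \<in> borel_measurable (sigma_gen M NS XS)" by simp
    have "\<P>(\<omega> in M. XS \<omega> \<in> A \<and> Y \<omega> = 1) = (\<integral>\<omega>. ?a \<omega> * label_ind 1 \<omega> \<partial>M)"
      by (rule integral_indicator_label[symmetric])
    also have "\<dots> = (\<integral>\<omega>. ?a \<omega> * pS \<omega> \<partial>M)"
      by (rule integral_mult_label(1)[OF XS a]) simp
    also have "\<dots> = (\<integral>\<omega>. ?a \<omega> * ?p \<partial>M)"
      by (rule integral_cong_AE) (use const in \<open>auto elim!: eventually_mono\<close>)
    also have "\<dots> = \<P>(\<omega> in M. XS \<omega> \<in> A) * ?p"
      by (simp add: Int_def conj_ac)
    finally show False using A(2) by simp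
  qed
  moreover have "0 \<le> (\<integral>\<omega>. ?v \<omega> \<partial>M)" by (rule Bochner_Integration.integral_nonneg) simp
  ultimately show ?thesis using Ev by linarith
qed

context
  fixes Yh :: "'w \<Rightarrow> nat"
  assumes pl: "pseudo_label M NS NU XS XU Y Yh"
begin

lemma pseudo_sets [measurable]: "{\<omega> \<in> space M. Yh \<omega> = 1} \<in> sets M"
  using pl sets_measurable_Collect[of Yh bit_space "{1}"] by (simp add: pseudo_label_def)

lemma pseudo_cases: "\<omega> \<in> space M \<Longrightarrow> Yh \<omega> = 0 \<or> Yh \<omega> = 1"
  using pl measurable_space[of Yh M bit_space] by (auto simp: pseudo_label_def)

text \<open>Given \<open>XS\<close>, the event \<open>Yh = 1\<close> splits off with conditional
  probability \<open>pS\<close>. As \<open>pS\<close> is itself a function of \<open>XS\<close>, the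
  remaining conditional probability can be replaced by its indicator under the integral. Thus
  \<open>Yh\<close> disappears from all further computations.\<close>

lemma prob_pseudo:
  assumes D: "D \<in> sets (NU \<Otimes>\<^sub>M bit_space)"
  shows "\<P>(\<omega> in M. Yh \<omega> = 1 \<and> (XU \<omega>, Y \<omega>) \<in> D) =
    (\<integral>\<omega>. pS \<omega> * indicator {\<omega> \<in> space M. (XU \<omega>, Y \<omega>) \<in> D} \<omega> \<partial>M)"
proof -
  let ?C = "\<lambda>P. cond_pr M (sigma_gen M NS XS) P"
  have UY: "(\<lambda>\<omega>. (XU \<omega>, Y \<omega>)) \<in> measurable M (NU \<Otimes>\<^sub>M bit_space)"
    by (rule measurable_Pair[OF XU Y])
  have DM: "{\<omega> \<in> space M. (XU \<omega>, Y \<omega>) \<in> D} \<in> sets M"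
    by (rule sets_measurable_Collect[OF UY D])
  have YD: "{\<omega> \<in> space M. Yh \<omega> = 1 \<and> (XU \<omega>, Y \<omega>) \<in> D} \<in> sets M"
    by (rule sets.sets_Collect_conj[OF DM pseudo_sets])
  have "{1} \<in> sets bit_space" by simp
  then have "AE \<omega> in M. ?C (\<lambda>\<omega>. Yh \<omega> \<in> {1} \<and> (XU \<omega>, Y \<omega>) \<in> D) \<omega> =
      ?C (\<lambda>\<omega>. Yh \<omega> \<in> {1}) \<omega> * ?C (\<lambda>\<omega>. (XU \<omega>, Y \<omega>) \<in> D) \<omega>"
    using pl D unfolding pseudo_label_def cond_indep_rv_def by blast
  moreover have "AE \<omega> in M. ?C (\<lambda>\<omega>. Yh \<omega> = 1) \<omega> = pS \<omega>"
    using pl unfolding pseudo_label_def by blast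
  ultimately have ae: "AE \<omega> in M. ?C (\<lambda>\<omega>. Yh \<omega> = 1 \<and> (XU \<omega>, Y \<omega>) \<in> D) \<omega> =
      pS \<omega> * ?C (\<lambda>\<omega>. (XU \<omega>, Y \<omega>) \<in> D) \<omega>"
    unfolding singleton_iff by eventually_elim simp
  have "\<P>(\<omega> in M. Yh \<omega> = 1 \<and> (XU \<omega>, Y \<omega>) \<in> D) =
      (\<integral>\<omega>. ?C (\<lambda>\<omega>. Yh \<omega> = 1 \<and> (XU \<omega>, Y \<omega>) \<in> D) \<omega> \<partial>M)"
    using integral_cond_pr[OF XS YD, of "\<lambda>_. 1"] by (simp add: Int_def conj_ac)
  also have "\<dots> = (\<integral>\<omega>. pS \<omega> * ?C (\<lambda>\<omega>. (XU \<omega>, Y \<omega>) \<in> D) \<omega> \<partial>M)"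
    using ae by (intro integral_cong_AE) simp_all
  also have "\<dots> = (\<integral>\<omega>. pS \<omega> * indicator {\<omega> \<in> space M. (XU \<omega>, Y \<omega>) \<in> D} \<omega> \<partial>M)"
    by (rule integral_cond_pr[OF XS DM pS_meas AE_abs_pS])
  finally show ?thesis .
qed

lemma prob_pseudo_label:
  assumes y: "y \<in> {0, 1}"
  shows "\<P>(\<omega> in M. Yh \<omega> = 1 \<and> Y \<omega> = y) = (\<integral>\<omega>. pS \<omega> * label_ind y \<omega> \<partial>M)"
proof -
  have "{\<omega> \<in> space M. Yh \<omega> = 1 \<and> (XU \<omega>, Y \<omega>) \<in> space NU \<times> {y}} = {\<omega> \<in> space M. Yh \<omega> = 1 \<and> Y \<omega> = y}"
    "{\<omega> \<in> space M. (XU \<omega>, Y \<omega>) \<in> space NU \<times> {y}} = {\<omega> \<in> space M. Y \<omega> = y}"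
    using measurable_space[OF XU] by auto
  moreover have "space NU \<times> {y} \<in> sets (NU \<Otimes>\<^sub>M bit_space)"
    using y by (intro pair_measureI) auto
  ultimately show ?thesis
    using prob_pseudo[of "space NU \<times> {y}"] unfolding label_ind_def by simp
qed

text \<open>The error mass on \<open>Y = 0\<close> is E[f (1 - f)], that is
  \<open>label_prob 1 - pS_moment\<close>.\<close>

lemma pseudo_label_accuracies:
  "\<P>(\<omega> in M. Yh \<omega> = 1 \<bar> Y \<omega> = 1) = pS_moment / label_prob 1"
  "\<P>(\<omega> in M. Yh \<omega> = 0 \<bar> Y \<omega> = 0) = 1 - (label_prob 1 - pS_moment) / label_prob 0"
proof -
  show "\<P>(\<omega> in M. Yh \<omega> = 1 \<bar> Y \<omega> = 1) = pS_moment / label_prob 1"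
    unfolding cond_prob_def using prob_pseudo_label[of 1] integral_pS_label(2)
    by (simp add: label_prob_def)
  have sets01: "{\<omega> \<in> space M. Yh \<omega> = 1 \<and> Y \<omega> = 0} \<in> sets M"
    by (rule sets.sets_Collect_conj[OF label_sets pseudo_sets])
  have "{\<omega> \<in> space M. Yh \<omega> = 0 \<and> Y \<omega> = 0} =
      {\<omega> \<in> space M. Y \<omega> = 0} - {\<omega> \<in> space M. Yh \<omega> = 1 \<and> Y \<omega> = 0}"
    using pseudo_cases by auto
  then have "\<P>(\<omega> in M. Yh \<omega> = 0 \<and> Y \<omega> = 0) = label_prob 0 - \<P>(\<omega> in M. Yh \<omega> = 1 \<and> Y \<omega> = 0)"
    unfolding label_prob_def by (simp only:) (intro finite_measure_Diff[OF label_sets sets01], blast)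
  also have "\<dots> = label_prob 0 - (label_prob 1 - pS_moment)"
    using prob_pseudo_label[of 0] integral_pS_label(3) by simp
  finally show "\<P>(\<omega> in M. Yh \<omega> = 0 \<bar> Y \<omega> = 0) = 1 - (label_prob 1 - pS_moment) / label_prob 0"
    unfolding cond_prob_def using label_prob_pos[of 0]
    by (simp add: diff_divide_distrib flip: label_prob_def)
qed

text \<open>Total probability over the label: within a class the two views factorise, so the chance
  of \<open>Yh = 1\<close> is there a constant that does not depend on \<open>XU\<close>. The two
  constants are \<epsilon>1 and 1 - \<epsilon>0, weighted by the posterior and its
  complement.\<close>

lemma pseudo_label_given_XU:
  "AE \<omega> in M. cond_pr M (sigma_gen M NU XU) (\<lambda>\<omega>. Yh \<omega> = 1) \<omega> =
    pS_moment / label_prob 1 * pU \<omega> + (label_prob 1 - pS_moment) / label_prob 0 * (1 - pU \<omega>)"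
    (is "AE \<omega> in M. _ = ?g \<omega>")
proof -
  interpret FU: sigma_finite_subalgebra M "sigma_gen M NU XU"
    by (rule sigma_finite_subalgebra_sigma_gen[OF XU])
  have pq: "0 < label_prob 1" "0 < label_prob 0" by (rule label_prob_pos; simp)+
  have ipU: "integrable M pU"
    by (rule integrable_bounded) (simp_all add: AE_abs_cond_pr[OF XU label_sets])
  have ig: "integrable M ?g" using ipU by simp
  have "AE \<omega> in M. real_cond_exp M (sigma_gen M NU XU) (indicator {\<omega> \<in> space M. Yh \<omega> = 1}) \<omega> = ?g \<omega>"
  proof (rule FU.real_cond_exp_charact)
    fix b assume b: "b \<in> sets (sigma_gen M NU XU)"
    have spU: "XU \<in> space M \<rightarrow> space NU" using measurable_space[OF XU] by auto
    obtain B where B: "B \<in> sets NU" "b = {\<omega> \<in> space M. XU \<omega> \<in> B}"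
      using b unfolding sets_sigma_gen[OF spU] by blast
    have bM[measurable]: "b \<in> sets M" unfolding B(2) by (rule sets_measurable_Collect[OF XU B(1)])
    have bF: "indicator b \<in> borel_measurable (sigma_gen M NU XU)" using b by simp
    have b1: "AE \<omega> in M. \<bar>indicator b \<omega> :: real\<bar> \<le> 1" by (simp add: indicator_def)
    have ib: "integrable M (\<lambda>\<omega>. indicator b \<omega> * h \<omega>)" if "integrable M h" for h :: "'w \<Rightarrow> real"
      using integrable_mult_indicator[OF bM that] by simp
    have il: "integrable M (\<lambda>\<omega>. pS \<omega> * indicator b \<omega> * label_ind y \<omega>)" for y
    proof (rule integrable_bounded)
      show "AE \<omega> in M. \<bar>pS \<omega> * indicator b \<omega> * label_ind y \<omega>\<bar> \<le> 1"
        using AE_abs_pS b1 by eventually_elim (simp add: abs_mult mult_le_one abs_label_ind)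
    qed measurable
    let ?I1 = "\<integral>\<omega>. indicator b \<omega> * pU \<omega> \<partial>M" and ?I0 = "\<integral>\<omega>. indicator b \<omega> * (1 - pU \<omega>) \<partial>M"
    have "(\<integral>\<omega>\<in>b. (indicator {\<omega> \<in> space M. Yh \<omega> = 1} \<omega> :: real) \<partial>M) =
        (\<integral>\<omega>. indicator {\<omega> \<in> space M. Yh \<omega> = 1} \<omega> * indicator {\<omega> \<in> space M. XU \<omega> \<in> B} \<omega> \<partial>M)"
      by (simp add: set_lebesgue_integral_def B(2) mult.commute)
    also have "\<dots> = \<P>(\<omega> in M. Yh \<omega> = 1 \<and> XU \<omega> \<in> B)"
      by (rule integral_indicator_mult_indicator)
    also have "\<dots> = (\<integral>\<omega>. pS \<omega> * indicator b \<omega> \<partial>M)"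
    proof -
      \<comment> \<open>The label coordinate is left free, so only \<open>XU\<close> is
        constrained.\<close>
      have "B \<times> {0, 1} \<in> sets (NU \<Otimes>\<^sub>M bit_space)"
        using B(1) by (intro pair_measureI) auto
      moreover have "{\<omega> \<in> space M. Yh \<omega> = 1 \<and> (XU \<omega>, Y \<omega>) \<in> B \<times> {0, 1}} = {\<omega> \<in> space M. Yh \<omega> = 1 \<and> XU \<omega> \<in> B}"
        "{\<omega> \<in> space M. (XU \<omega>, Y \<omega>) \<in> B \<times> {0, 1}} = b"
        unfolding B(2) using label_cases by auto
      ultimately show ?thesis using prob_pseudo[of "B \<times> {0, 1}"] by simp
    qed
    also have "\<dots> = (\<integral>\<omega>. pS \<omega> * indicator b \<omega> * label_ind 1 \<omega> + pS \<omega> * indicator b \<omega> * label_ind 0 \<omega> \<partial>M)"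
      by (intro Bochner_Integration.integral_cong refl, simp only: label_ind_0) (simp add: algebra_simps)
    also have "\<dots> = (\<integral>\<omega>. pS \<omega> * indicator b \<omega> * label_ind 1 \<omega> \<partial>M) + (\<integral>\<omega>. pS \<omega> * indicator b \<omega> * label_ind 0 \<omega> \<partial>M)"
      by (rule Bochner_Integration.integral_add[OF il il])
    \<comment> \<open>Factorisation with \<phi> = \<open>pS\<close> and \<psi> the indicator of
      \<open>b\<close>; the factor from \<open>XS\<close> becomes \<open>pS_moment\<close>.\<close>
    also have "(\<integral>\<omega>. pS \<omega> * indicator b \<omega> * label_ind 1 \<omega> \<partial>M) = pS_moment / label_prob 1 * ?I1"
      using integral_views_label[OF pS_meas AE_abs_pS bF b1, of 1] pq
      unfolding integral_pS_label integral_mult_label[OF XU bF b1] by (simp add: field_simps)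
    also have "(\<integral>\<omega>. pS \<omega> * indicator b \<omega> * label_ind 0 \<omega> \<partial>M) = (label_prob 1 - pS_moment) / label_prob 0 * ?I0"
      using integral_views_label[OF pS_meas AE_abs_pS bF b1, of 0] pq
      unfolding integral_pS_label integral_mult_label[OF XU bF b1] by (simp add: field_simps)
    also have "pS_moment / label_prob 1 * ?I1 + (label_prob 1 - pS_moment) / label_prob 0 * ?I0 =
        (\<integral>\<omega>. pS_moment / label_prob 1 * (indicator b \<omega> * pU \<omega>) +
          (label_prob 1 - pS_moment) / label_prob 0 * (indicator b \<omega> * (1 - pU \<omega>)) \<partial>M)"
      using ib[OF ipU] ib[of "\<lambda>\<omega>. 1 - pU \<omega>"] ipU by simp
    also have "\<dots> = (\<integral>\<omega>\<in>b. ?g \<omega> \<partial>M)"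
      unfolding set_lebesgue_integral_def
      by (intro Bochner_Integration.integral_cong) (auto split: split_indicator)
    finally show "(\<integral>\<omega>\<in>b. (indicator {\<omega> \<in> space M. Yh \<omega> = 1} \<omega> :: real) \<partial>M) = (\<integral>\<omega>\<in>b. ?g \<omega> \<partial>M)" .
  next
    show "integrable M (indicator {\<omega> \<in> space M. Yh \<omega> = 1} :: 'w \<Rightarrow> real)"
      by (rule integrable_real_indicator[OF pseudo_sets]) (simp add: emeasure_eq_measure)
  qed (use ig in simp_all)
  then show ?thesis by (simp add: cond_pr_def)
qed

text \<open>The posterior of \<open>Yh\<close> is an affine function of \<open>pU\<close> with slope
  \<epsilon>0 + \<epsilon>1 - 1. Strict positivity of the slope comes from
  \<open>pS_moment_gt\<close>, and it justifies the division.\<close>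

lemma pseudo_label_debiasing:
  fixes \<epsilon>0 \<epsilon>1 :: real
  assumes "\<epsilon>0 = \<P>(\<omega> in M. Yh \<omega> = 0 \<bar> Y \<omega> = 0)" "\<epsilon>1 = \<P>(\<omega> in M. Yh \<omega> = 1 \<bar> Y \<omega> = 1)"
  shows "\<epsilon>0 + \<epsilon>1 > 1"
    and "AE \<omega> in M. pU \<omega> =
      (cond_pr M (sigma_gen M NU XU) (\<lambda>\<omega>. Yh \<omega> = 1) \<omega> + \<epsilon>0 - 1) / (\<epsilon>0 + \<epsilon>1 - 1)"
proof -
  let ?p = "label_prob 1" and ?q = "label_prob 0"
  have pq: "0 < ?p" "0 < ?q" by (rule label_prob_pos; simp)+
  have e0: "\<epsilon>0 = 1 - (?p - pS_moment) / ?q" and e1: "\<epsilon>1 = pS_moment / ?p"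
    using assms pseudo_label_accuracies by simp_all
  have "\<epsilon>0 + \<epsilon>1 - 1 = (pS_moment * (?p + ?q) - ?p * ?p) / (?p * ?q)"
    unfolding e0 e1 using pq by (simp add: field_simps)
  also have "\<dots> = (pS_moment - ?p * ?p) / (?p * ?q)"
    using label_prob_0 by simp
  also have "\<dots> > 0"
    using pS_moment_gt pq by simp
  finally show gt: "\<epsilon>0 + \<epsilon>1 > 1" by simp
  show "AE \<omega> in M. pU \<omega> =
      (cond_pr M (sigma_gen M NU XU) (\<lambda>\<omega>. Yh \<omega> = 1) \<omega> + \<epsilon>0 - 1) / (\<epsilon>0 + \<epsilon>1 - 1)"
    using pseudo_label_given_XU
  proof eventually_elim
    case (elim \<omega>)
    have "cond_pr M (sigma_gen M NU XU) (\<lambda>\<omega>. Yh \<omega> = 1) \<omega> = \<epsilon>1 * pU \<omega> + (1 - \<epsilon>0) * (1 - pU \<omega>)"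
      using elim unfolding e0 e1 by simp
    then have "pU \<omega> * (\<epsilon>0 + \<epsilon>1 - 1) = cond_pr M (sigma_gen M NU XU) (\<lambda>\<omega>. Yh \<omega> = 1) \<omega> + \<epsilon>0 - 1"
      by (simp add: algebra_simps)
    then show ?case using gt by (simp add: eq_divide_eq)
  qed
qed

end

end

section \<open>Uniqueness of the joint law\<close>

text \<open>Adding the two class factorisations gives Pr[XS in A, XU in B]. The result is linear in
  the unknown Pr[XU in B, Y = 1], since the only products of unknowns involve quantities of
  \<open>XS\<close> and \<open>Y\<close>, which are known; all other terms come from the two given
  laws.\<close>

lemma (in two_views) prob_XU_label:
  assumes A: "A \<in> sets NS" and B: "B \<in> sets NU"
  shows "\<P>(\<omega> in M. XU \<omega> \<in> B \<and> Y \<omega> = 1) *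
      (\<P>(\<omega> in M. XS \<omega> \<in> A \<and> Y \<omega> = 1) - \<P>(\<omega> in M. XS \<omega> \<in> A) * label_prob 1) =
    \<P>(\<omega> in M. XS \<omega> \<in> A \<and> XU \<omega> \<in> B) * label_prob 0 * label_prob 1 -
      (\<P>(\<omega> in M. XS \<omega> \<in> A) - \<P>(\<omega> in M. XS \<omega> \<in> A \<and> Y \<omega> = 1)) * \<P>(\<omega> in M. XU \<omega> \<in> B) * label_prob 1"
proof -
  have a: "{\<omega> \<in> space M. XS \<omega> \<in> A} \<in> sets M" and b: "{\<omega> \<in> space M. XU \<omega> \<in> B} \<in> sets M"
    using sets_measurable_Collect XS XU A B by blast+
  have ab: "{\<omega> \<in> space M. XS \<omega> \<in> A \<and> XU \<omega> \<in> B} \<in> sets M"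
    by (rule sets.sets_Collect_conj[OF b a])
  \<comment> \<open>Here \<open>c\<close>, \<open>d\<close> are the probabilities of the rectangle
    within \<open>Y = 1\<close> and \<open>Y = 0\<close>, \<open>a\<close> and \<open>b\<close>
    those of the two sides, and \<open>a1\<close>, \<open>b1\<close> those of the sides within
    \<open>Y = 1\<close>.\<close>
  have 1: "c * p = a1 * b1 \<Longrightarrow> d * q = (a - a1) * (b - b1) \<Longrightarrow> q = 1 - p \<Longrightarrow>
      b1 * (a1 - a * p) = (d + c) * q * p - (a - a1) * b * p" for a a1 b b1 c d p q :: real
  proof -
    assume h: "c * p = a1 * b1" "d * q = (a - a1) * (b - b1)" "q = 1 - p"
    have "(d + c) * q * p = (a - a1) * (b - b1) * p + a1 * b1 * q"
      unfolding h(1)[symmetric] h(2)[symmetric] by (simp add: algebra_simps)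
    then show ?thesis unfolding h(3) by (simp add: algebra_simps)
  qed
  show ?thesis
    unfolding prob_label_split[OF ab]
  proof (rule 1)
    show "\<P>(\<omega> in M. (XS \<omega> \<in> A \<and> XU \<omega> \<in> B) \<and> Y \<omega> = 1) * label_prob 1 =
        \<P>(\<omega> in M. XS \<omega> \<in> A \<and> Y \<omega> = 1) * \<P>(\<omega> in M. XU \<omega> \<in> B \<and> Y \<omega> = 1)"
      using prob_view_label[OF A B, of 1] by (simp add: conj_assoc)
    show "\<P>(\<omega> in M. (XS \<omega> \<in> A \<and> XU \<omega> \<in> B) \<and> Y \<omega> = 0) * label_prob 0 =
        (\<P>(\<omega> in M. XS \<omega> \<in> A) - \<P>(\<omega> in M. XS \<omega> \<in> A \<and> Y \<omega> = 1)) *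
        (\<P>(\<omega> in M. XU \<omega> \<in> B) - \<P>(\<omega> in M. XU \<omega> \<in> B \<and> Y \<omega> = 1))"
      using prob_view_label[OF A B, of 0] unfolding prob_label_split[OF a] prob_label_split[OF b]
      by (simp add: conj_assoc)
  qed (rule label_prob_0)
qed

text \<open>The given laws supply the coefficients of \<open>prob_XU_label\<close>, which yields the
  law of \<open>XU\<close> within each class; conditional independence then rebuilds the law of the
  triple on boxes.\<close>

lemma two_views_label_law_cong:
  assumes T: "two_views M NS NU XS XU Y" and T': "two_views M' NS NU XS' XU' Y'"
    and SY: "distr M' (NS \<Otimes>\<^sub>M bit_space) (\<lambda>\<omega>. (XS' \<omega>, Y' \<omega>)) =
      distr M (NS \<Otimes>\<^sub>M bit_space) (\<lambda>\<omega>. (XS \<omega>, Y \<omega>))"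
    and SU: "distr M' (NS \<Otimes>\<^sub>M NU) (\<lambda>\<omega>. (XS' \<omega>, XU' \<omega>)) =
      distr M (NS \<Otimes>\<^sub>M NU) (\<lambda>\<omega>. (XS \<omega>, XU \<omega>))"
  shows "distr M' (NS \<Otimes>\<^sub>M NU \<Otimes>\<^sub>M bit_space) (\<lambda>\<omega>. (XS' \<omega>, XU' \<omega>, Y' \<omega>)) =
    distr M (NS \<Otimes>\<^sub>M NU \<Otimes>\<^sub>M bit_space) (\<lambda>\<omega>. (XS \<omega>, XU \<omega>, Y \<omega>))"
proof -
  interpret T: two_views M NS NU XS XU Y by fact
  interpret T': two_views M' NS NU XS' XU' Y' by fact
  have SYm: "(\<lambda>\<omega>. (XS \<omega>, Y \<omega>)) \<in> measurable M (NS \<Otimes>\<^sub>M bit_space)"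
    "(\<lambda>\<omega>. (XS' \<omega>, Y' \<omega>)) \<in> measurable M' (NS \<Otimes>\<^sub>M bit_space)"
    by (rule measurable_Pair[OF T.XS T.Y] measurable_Pair[OF T'.XS T'.Y])+
  have SUYm: "(\<lambda>\<omega>. (XS \<omega>, XU \<omega>, Y \<omega>)) \<in> measurable M (NS \<Otimes>\<^sub>M NU \<Otimes>\<^sub>M bit_space)"
    "(\<lambda>\<omega>. (XS' \<omega>, XU' \<omega>, Y' \<omega>)) \<in> measurable M' (NS \<Otimes>\<^sub>M NU \<Otimes>\<^sub>M bit_space)"
    by (rule measurable_Pair[OF T.XS measurable_Pair[OF T.XU T.Y]]
        measurable_Pair[OF T'.XS measurable_Pair[OF T'.XU T'.Y]])+
  have pSY: "\<P>(\<omega> in M'. XS' \<omega> \<in> A \<and> Y' \<omega> = y) = \<P>(\<omega> in M. XS \<omega> \<in> A \<and> Y \<omega> = y)"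
    if "A \<in> sets NS" "y \<in> {0, 1}" for A y
  proof -
    have D: "A \<times> {y} \<in> sets (NS \<Otimes>\<^sub>M bit_space)"
      using that by (intro pair_measureI) auto
    show ?thesis
      using arg_cong[OF SY, of "\<lambda>\<mu>. measure \<mu> (A \<times> {y})"]
      unfolding measure_distr[OF SYm(1) D] measure_distr[OF SYm(2) D]
      by (simp add: vimage_def Int_def conj_ac)
  qed
  have pSU: "\<P>(\<omega> in M'. XS' \<omega> \<in> A \<and> XU' \<omega> \<in> B) = \<P>(\<omega> in M. XS \<omega> \<in> A \<and> XU \<omega> \<in> B)"
    if "A \<in> sets NS" "B \<in> sets NU" for A B
  proof -
    have D: "A \<times> B \<in> sets (NS \<Otimes>\<^sub>M NU)"
      using that by (intro pair_measureI) auto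
    show ?thesis
      using arg_cong[OF SU, of "\<lambda>\<mu>. measure \<mu> (A \<times> B)"]
      unfolding measure_distr[OF T.views_pair D] measure_distr[OF T'.views_pair D]
      by (simp add: vimage_def Int_def conj_ac)
  qed
  \<comment> \<open>Taking the full space as the other side of a rectangle reads off the
    marginals.\<close>
  have in_S: "{\<omega> \<in> space M. XS \<omega> \<in> space NS \<and> R \<omega>} = {\<omega> \<in> space M. R \<omega>}"
    "{\<omega> \<in> space M'. XS' \<omega> \<in> space NS \<and> R' \<omega>} = {\<omega> \<in> space M'. R' \<omega>}" for R R'
    using measurable_space[OF T.XS] measurable_space[OF T'.XS] by auto
  have in_U: "{\<omega> \<in> space M. R \<omega> \<and> XU \<omega> \<in> space NU} = {\<omega> \<in> space M. R \<omega>}"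
    "{\<omega> \<in> space M'. R' \<omega> \<and> XU' \<omega> \<in> space NU} = {\<omega> \<in> space M'. R' \<omega>}" for R R'
    using measurable_space[OF T.XU] measurable_space[OF T'.XU] by auto
  have pY: "T'.label_prob y = T.label_prob y" if "y \<in> {0, 1}" for y
    using pSY[OF sets.top that] unfolding in_S T.label_prob_def T'.label_prob_def .
  have pS: "\<P>(\<omega> in M'. XS' \<omega> \<in> A) = \<P>(\<omega> in M. XS \<omega> \<in> A)" if "A \<in> sets NS" for A
    using pSU[OF that sets.top] unfolding in_U .
  have pU: "\<P>(\<omega> in M'. XU' \<omega> \<in> B) = \<P>(\<omega> in M. XU \<omega> \<in> B)" if "B \<in> sets NU" for B
    using pSU[OF sets.top that] unfolding in_S .
  \<comment> \<open>Chosen in \<open>M\<close>, this set serves \<open>M'\<close> as well, because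
    the laws of (XS, Y) coincide.\<close>
  obtain A0 where A0: "A0 \<in> sets NS"
    "\<P>(\<omega> in M. XS \<omega> \<in> A0 \<and> Y \<omega> = 1) \<noteq> \<P>(\<omega> in M. XS \<omega> \<in> A0) * T.label_prob 1"
    by (rule T.dependent_set)
  have pU1: "\<P>(\<omega> in M'. XU' \<omega> \<in> B \<and> Y' \<omega> = 1) = \<P>(\<omega> in M. XU \<omega> \<in> B \<and> Y \<omega> = 1)"
    if B: "B \<in> sets NU" for B
  proof -
    have 01: "(1::nat) \<in> {0, 1}" "(0::nat) \<in> {0, 1}" by simp_all
    have "\<P>(\<omega> in M'. XU' \<omega> \<in> B \<and> Y' \<omega> = 1) *
        (\<P>(\<omega> in M. XS \<omega> \<in> A0 \<and> Y \<omega> = 1) - \<P>(\<omega> in M. XS \<omega> \<in> A0) * T.label_prob 1) =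
      \<P>(\<omega> in M. XU \<omega> \<in> B \<and> Y \<omega> = 1) *
        (\<P>(\<omega> in M. XS \<omega> \<in> A0 \<and> Y \<omega> = 1) - \<P>(\<omega> in M. XS \<omega> \<in> A0) * T.label_prob 1)"
      \<comment> \<open>After rewriting, all coefficients are those of \<open>M\<close>, so both
        unknowns satisfy one linear equation; \<open>A0\<close> makes its leading coefficient
        nonzero.\<close>
      using T'.prob_XU_label[OF A0(1) B]
      unfolding pSY[OF A0(1) 01(1)] pS[OF A0(1)] pU[OF B] pSU[OF A0(1) B] pY[OF 01(1)] pY[OF 01(2)]
        T.prob_XU_label[OF A0(1) B] .
    then show ?thesis using A0(2) by simp
  qed
  have pU_label: "\<P>(\<omega> in M'. XU' \<omega> \<in> B \<and> Y' \<omega> = y) = \<P>(\<omega> in M. XU \<omega> \<in> B \<and> Y \<omega> = y)"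
    if B: "B \<in> sets NU" and y: "y \<in> {0, 1}" for B y
  proof -
    have "\<P>(\<omega> in M'. XU' \<omega> \<in> B \<and> Y' \<omega> = 0) = \<P>(\<omega> in M. XU \<omega> \<in> B \<and> Y \<omega> = 0)"
      using pU[OF B] pU1[OF B] T.prob_label_split[OF T.sets_measurable_Collect[OF T.XU B]]
        T'.prob_label_split[OF T'.sets_measurable_Collect[OF T'.XU B]] by linarith
    with pU1[OF B] show ?thesis using y by (elim insertE) simp_all
  qed
  have pSUY: "\<P>(\<omega> in M'. XS' \<omega> \<in> A \<and> XU' \<omega> \<in> B \<and> Y' \<omega> = y) = \<P>(\<omega> in M. XS \<omega> \<in> A \<and> XU \<omega> \<in> B \<and> Y \<omega> = y)"
    if A: "A \<in> sets NS" and B: "B \<in> sets NU" and y: "y \<in> {0, 1}" for A B y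
  proof -
    have "\<P>(\<omega> in M'. XS' \<omega> \<in> A \<and> XU' \<omega> \<in> B \<and> Y' \<omega> = y) * T.label_prob y =
        \<P>(\<omega> in M. XS \<omega> \<in> A \<and> XU \<omega> \<in> B \<and> Y \<omega> = y) * T.label_prob y"
      using T'.prob_view_label[OF A B y]
      unfolding pSY[OF A y] pU_label[OF B y] pY[OF y] T.prob_view_label[OF A B y] .
    then show ?thesis using T.label_prob_pos[OF y] by simp
  qed
  show ?thesis
  proof (rule emeasure_eqI_triple)
    show "finite_measure (distr M' (NS \<Otimes>\<^sub>M NU \<Otimes>\<^sub>M bit_space) (\<lambda>\<omega>. (XS' \<omega>, XU' \<omega>, Y' \<omega>)))"
      by (rule T'.finite_measure_distr[OF SUYm(2)])
    fix A B and Z :: "nat set" assume s: "A \<in> sets NS" "B \<in> sets NU" "Z \<in> sets bit_space"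
    have D: "A \<times> B \<times> Z \<in> sets (NS \<Otimes>\<^sub>M NU \<Otimes>\<^sub>M bit_space)"
      using s by (intro pair_measureI)
    have ZM: "{\<omega> \<in> space M. (XS \<omega>, XU \<omega>, Y \<omega>) \<in> A \<times> B \<times> Z} \<in> sets M"
      by (rule T.sets_measurable_Collect[OF SUYm(1) D])
    have ZM': "{\<omega> \<in> space M'. (XS' \<omega>, XU' \<omega>, Y' \<omega>) \<in> A \<times> B \<times> Z} \<in> sets M'"
      by (rule T'.sets_measurable_Collect[OF SUYm(2) D])
    \<comment> \<open>A box with an arbitrary set \<open>Z\<close> of labels is cut into label
      classes: each is a box with a single label, or empty when that label is not in
      \<open>Z\<close>.\<close>
    have fix_y: "\<P>(\<omega> in M. (XS \<omega>, XU \<omega>, Y \<omega>) \<in> A \<times> B \<times> Z \<and> Y \<omega> = y) =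
        \<P>(\<omega> in M'. (XS' \<omega>, XU' \<omega>, Y' \<omega>) \<in> A \<times> B \<times> Z \<and> Y' \<omega> = y)" if y: "y \<in> {0, 1}" for y
    proof (cases "y \<in> Z")
      case True
      then have "{\<omega> \<in> space M. (XS \<omega>, XU \<omega>, Y \<omega>) \<in> A \<times> B \<times> Z \<and> Y \<omega> = y} =
          {\<omega> \<in> space M. XS \<omega> \<in> A \<and> XU \<omega> \<in> B \<and> Y \<omega> = y}"
        "{\<omega> \<in> space M'. (XS' \<omega>, XU' \<omega>, Y' \<omega>) \<in> A \<times> B \<times> Z \<and> Y' \<omega> = y} =
          {\<omega> \<in> space M'. XS' \<omega> \<in> A \<and> XU' \<omega> \<in> B \<and> Y' \<omega> = y}"
        by blast+
      then show ?thesis by (simp only: pSUY[OF s(1,2) y])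
    next
      case False
      then have "{\<omega> \<in> space M. (XS \<omega>, XU \<omega>, Y \<omega>) \<in> A \<times> B \<times> Z \<and> Y \<omega> = y} = {}"
        "{\<omega> \<in> space M'. (XS' \<omega>, XU' \<omega>, Y' \<omega>) \<in> A \<times> B \<times> Z \<and> Y' \<omega> = y} = {}"
        by blast+
      then show ?thesis by (simp only: measure_empty)
    qed
    have "\<P>(\<omega> in M'. (XS' \<omega>, XU' \<omega>, Y' \<omega>) \<in> A \<times> B \<times> Z) = \<P>(\<omega> in M. (XS \<omega>, XU \<omega>, Y \<omega>) \<in> A \<times> B \<times> Z)"
      unfolding T.prob_label_split[OF ZM] T'.prob_label_split[OF ZM']
      by (simp only: fix_y insertI1 insertI2)
    moreover have "(\<lambda>\<omega>. (XS \<omega>, XU \<omega>, Y \<omega>)) -` (A \<times> B \<times> Z) \<inter> space M =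
        {\<omega> \<in> space M. (XS \<omega>, XU \<omega>, Y \<omega>) \<in> A \<times> B \<times> Z}"
      "(\<lambda>\<omega>. (XS' \<omega>, XU' \<omega>, Y' \<omega>)) -` (A \<times> B \<times> Z) \<inter> space M' =
        {\<omega> \<in> space M'. (XS' \<omega>, XU' \<omega>, Y' \<omega>) \<in> A \<times> B \<times> Z}"
      by blast+
    ultimately show "emeasure (distr M' (NS \<Otimes>\<^sub>M NU \<Otimes>\<^sub>M bit_space) (\<lambda>\<omega>. (XS' \<omega>, XU' \<omega>, Y' \<omega>))) (A \<times> B \<times> Z) =
        emeasure (distr M (NS \<Otimes>\<^sub>M NU \<Otimes>\<^sub>M bit_space) (\<lambda>\<omega>. (XS \<omega>, XU \<omega>, Y \<omega>))) (A \<times> B \<times> Z)"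
      unfolding emeasure_distr[OF SUYm(1) D] emeasure_distr[OF SUYm(2) D]
      by (simp only: T.emeasure_eq_measure T'.emeasure_eq_measure)
  qed (rule sets_distr)+
qed

theorem theorem4p4:
  fixes M :: "'w measure" and NS :: "'s measure" and NU :: "'u measure"
    and XS :: "'w \<Rightarrow> 's" and XU :: "'w \<Rightarrow> 'u" and Y :: "'w \<Rightarrow> nat"
  assumes "standard_borel NS" and "standard_borel NU"
    and "admissible_triple M NS NU XS XU Y"
  shows
    "(\<forall>(M' :: 'v measure) XS' XU' Y'.
        admissible_triple M' NS NU XS' XU' Y' \<and>
        distr M' (NS \<Otimes>\<^sub>M bit_space) (\<lambda>\<omega>. (XS' \<omega>, Y' \<omega>)) =
          distr M (NS \<Otimes>\<^sub>M bit_space) (\<lambda>\<omega>. (XS \<omega>, Y \<omega>)) \<and>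
        distr M' (NS \<Otimes>\<^sub>M NU) (\<lambda>\<omega>. (XS' \<omega>, XU' \<omega>)) =
          distr M (NS \<Otimes>\<^sub>M NU) (\<lambda>\<omega>. (XS \<omega>, XU \<omega>)) \<longrightarrow>
        distr M' (NS \<Otimes>\<^sub>M NU \<Otimes>\<^sub>M bit_space) (\<lambda>\<omega>. (XS' \<omega>, XU' \<omega>, Y' \<omega>)) =
          distr M (NS \<Otimes>\<^sub>M NU \<Otimes>\<^sub>M bit_space) (\<lambda>\<omega>. (XS \<omega>, XU \<omega>, Y \<omega>))) \<and>
     (\<forall>Yh. pseudo_label M NS NU XS XU Y Yh \<longrightarrow>
        (let \<epsilon>0 = \<P>(\<omega> in M. Yh \<omega> = 0 \<bar> Y \<omega> = 0);
             \<epsilon>1 = \<P>(\<omega> in M. Yh \<omega> = 1 \<bar> Y \<omega> = 1)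
         in \<epsilon>0 + \<epsilon>1 > 1 \<and>
            (AE \<omega> in M. cond_pr M (sigma_gen M NU XU) (\<lambda>\<omega>. Y \<omega> = 1) \<omega> =
               (cond_pr M (sigma_gen M NU XU) (\<lambda>\<omega>. Yh \<omega> = 1) \<omega> + \<epsilon>0 - 1) / (\<epsilon>0 + \<epsilon>1 - 1)))) \<and>
     (AE \<omega> in M.
        let pS = cond_pr M (sigma_gen M NS XS) (\<lambda>\<omega>. Y \<omega> = 1) \<omega>;
            pU = cond_pr M (sigma_gen M NU XU) (\<lambda>\<omega>. Y \<omega> = 1) \<omega>
        in \<not> (logit pS = \<infinity> \<and> logit pU = -\<infinity>) \<and> \<not> (logit pS = -\<infinity> \<and> logit pU = \<infinity>) \<and>
           cond_pr M (sigma_gen M (NS \<Otimes>\<^sub>M NU) (\<lambda>\<omega>. (XS \<omega>, XU \<omega>))) (\<lambda>\<omega>. Y \<omega> = 1) \<omega> =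
             sigmoid (logit pS + logit pU - logit \<P>(\<omega> in M. Y \<omega> = 1)))"
proof -
  have T: "two_views M NS NU XS XU Y"
    using assms(3) by (simp only: admissible_triple_iff_two_views)
  then interpret two_views M NS NU XS XU Y .
  show ?thesis
  proof (intro conjI allI impI; (elim conjE)?)
    fix M' :: "'v measure" and XS' XU' Y'
    assume T': "admissible_triple M' NS NU XS' XU' Y'"
      and "distr M' (NS \<Otimes>\<^sub>M bit_space) (\<lambda>\<omega>. (XS' \<omega>, Y' \<omega>)) =
          distr M (NS \<Otimes>\<^sub>M bit_space) (\<lambda>\<omega>. (XS \<omega>, Y \<omega>))"
        "distr M' (NS \<Otimes>\<^sub>M NU) (\<lambda>\<omega>. (XS' \<omega>, XU' \<omega>)) =
          distr M (NS \<Otimes>\<^sub>M NU) (\<lambda>\<omega>. (XS \<omega>, XU \<omega>))"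
    then show "distr M' (NS \<Otimes>\<^sub>M NU \<Otimes>\<^sub>M bit_space) (\<lambda>\<omega>. (XS' \<omega>, XU' \<omega>, Y' \<omega>)) =
          distr M (NS \<Otimes>\<^sub>M NU \<Otimes>\<^sub>M bit_space) (\<lambda>\<omega>. (XS \<omega>, XU \<omega>, Y \<omega>))"
      by (intro two_views_label_law_cong[OF T T'[unfolded admissible_triple_iff_two_views]])
  next
    fix Yh assume "pseudo_label M NS NU XS XU Y Yh"
    from pseudo_label_debiasing[OF this refl refl]
    show "let \<epsilon>0 = \<P>(\<omega> in M. Yh \<omega> = 0 \<bar> Y \<omega> = 0);
             \<epsilon>1 = \<P>(\<omega> in M. Yh \<omega> = 1 \<bar> Y \<omega> = 1)
         in \<epsilon>0 + \<epsilon>1 > 1 \<and>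
            (AE \<omega> in M. cond_pr M (sigma_gen M NU XU) (\<lambda>\<omega>. Y \<omega> = 1) \<omega> =
               (cond_pr M (sigma_gen M NU XU) (\<lambda>\<omega>. Yh \<omega> = 1) \<omega> + \<epsilon>0 - 1) / (\<epsilon>0 + \<epsilon>1 - 1))"
      unfolding Let_def by (rule conjI)
  qed (unfold Let_def, rule sigmoid_both_views)
qed

end
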